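(* Let $\varphi_1:\mathbb{R}^d\to\mathbb{R}\cup\{\infty\}$ and $\varphi_2:\mathbb{R}^d\to\mathbb{R}$ be lower semicontinuous, put $\varphi:=\varphi_1+\varphi_2$, let $F:\mathbb{R}^d\to\mathbb{R}^d$ and let $x_0\in\operatorname{dom}\varphi$. Suppose there is an open set $\Omega\subset\mathbb{R}^d$ such that $\{x\in\mathbb{R}^d:\varphi(x)\le\varphi(x_0)\}\subset\Omega$, $\varphi_1$ is primal lower regular on $\Omega$, $\varphi_2$ is locally Lipschitz on $\Omega$, and $F$ is locally Lipschitz on $\Omega$. Let $x(\cdot)$ be an energetic solution of $$0\in\partial\varphi_1(x(t))+\partial\varphi_2(x(t))+DF(x(t))(\dot x(t))\ \text{ for a.e. } t\in\mathbb{R}_+,\qquad x(0)=x_0,$$ let $\omega(x)$ be the set of $z\in\mathbb{R}^d$ for which there is $t_n\to\infty$ with $x(t_n)\to z$, and suppose $x^\ast\in\omega(x)$ is such that $\varphi$ satisfies the structured Kurdyka–Łojasiewicz property at $x^\ast$. Then $\dot x\in L^1(\mathbb{R}_+;\mathbb{R}^d)$, $x(t)\to x^\ast$ and $\varphi(x(t))\to\varphi(x^\ast)$ as $t\to\infty$.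
   Context: $\mathbb{R}^d$ carries the Euclidean norm $\|\cdot\|$ and inner product $\langle\cdot,\cdot\rangle$; $\mathbb{R}_+=[0,\infty)$; $\mathbb{B}_r(x)$ is the open ball; $\operatorname{dom} f=\{x:f(x)<\infty\}$; $\operatorname{dist}(x;S)=\inf_{y\in S}\|x-y\|$ ($=\infty$ if $S=\emptyset$). Tangent cone: for $A\subset\mathbb{R}^m$ and $a\in A$, $T_A(a)$ is the set of $v$ for which there exist $t_n>0$, $t_n\to0$, $v_n\to v$ with $a+t_nv_n\in A$ for all $n$. Fréchet normal cone: $\widehat N_A(a)=\{v:\langle v,w\rangle\le0\ \forall w\in T_A(a)\}$. Clarke normal cone: $N_A(a)=\overline{\operatorname{co}}\{v:\exists\, a_n\in A,\ v_n\in\widehat N_A(a_n),\ (a_n,v_n)\to(a,v)\}$. Clarke subdifferential of a lower semicontinuous $f:\mathbb{R}^d\to\mathbb{R}\cup\{\infty\}$ at $x$ with $f(x)<\infty$: $\partial f(x)=\{\zeta:(\zeta,-1)\in N_{\operatorname{epi}f}(x,f(x))\}$, where $\operatorname{epi}f=\{(x,\alpha):f(x)\le\alpha\}$; $\partial f(x)=\emptyset$ if $f(x)=\infty$; $\operatorname{dom}\partial f=\{x:\partial f(x)\ne\emptyset\}$. Primal lower regular (plr): $f$ is plr at $\bar x$ if there are $\varepsilon>0$, $c\ge0$ such that $f$ is lower semicontinuous on $\mathbb{B}_\varepsilon(\bar x)$ and for all $x\in\mathbb{B}_\varepsilon(\bar x)\cap\operatorname{dom}\partial f$ and all $\zeta\in\partial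 f(x)$, $f(y)\ge f(x)+\langle\zeta,y-x\rangle-c(1+\|\zeta\|)\|y-x\|^2$ for all $y\in\mathbb{B}_\varepsilon(\bar x)$. It is plr on an open set if it is plr at each of its points. Structured Kurdyka–Łojasiewicz property: $\varphi=\varphi_1+\varphi_2$ satisfies it at $x^\ast$ if there exist $\eta>0$ and a continuous concave function $\psi:[0,\eta]\to[0,\infty)$ with $\psi(0)=0$, $\mathcal{C}^1$ on $(0,\eta)$ with strictly positive derivative, such that $\psi'(\varphi(x)-\varphi(x^\ast))\operatorname{dist}(0;\partial\varphi_1(x)+\partial\varphi_2(x))\ge1$ for all $x\in\mathbb{B}_\eta(x^\ast)$ with $\varphi(x^\ast)<\varphi(x)<\varphi(x^\ast)+\eta$. Graphical derivative: $DF(x)(v)=\{u\in\mathbb{R}^d:(v,u)\in T_{\operatorname{gph}F}(x,F(x))\}$. Solution: $x:\mathbb{R}_+\to\mathbb{R}^d$ is a solution of the system if $x(0)=x_0$, $x$ is absolutely continuous on every compact interval of $\mathbb{R}_+$, and there exist $v,w\in L^2_{\rm loc}(\mathbb{R}_+;\mathbb{R}^d)$ with $v(t)\in\partial\varphi_1(x(t))$, $w(t)\in\partial\varphi_2(x(t))$ and $v(t)+w(t)\in-DF(x(t))(\dot x(t))$ for a.e. $t\in\mathbb{R}_+$. A solution is energetic if there exists $\rho>0$ such that $\rho\int_s^t\|\dot x(\tau)\|^2d\tau\le\varphi(x(s))-\varphi(x(t))$ for all $0\le s<t$. *)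

theory Defs
  imports "HOL-Analysis.Analysis"
begin

section \<open>Extended-real-valued functions\<close>

text \<open>Functions into the reals extended by plus infinity are modelled as functions into
  \<^typ>\<open>ereal\<close>; that they avoid minus infinity is a separate hypothesis where it is needed.\<close>

definition lsc_at :: "('a::topological_space \<Rightarrow> ereal) \<Rightarrow> 'a \<Rightarrow> bool" where
  "lsc_at f x \<longleftrightarrow> (\<forall>c < f x. eventually (\<lambda>y. c < f y) (nhds x))"

definition lsc_on :: "'a::topological_space set \<Rightarrow> ('a \<Rightarrow> ereal) \<Rightarrow> bool" where
  "lsc_on S f \<longleftrightarrow> (\<forall>x\<in>S. lsc_at f x)"

definition edom :: "('a \<Rightarrow> ereal) \<Rightarrow> 'a set" where
  "edom f = {x. f x < \<infinity>}"

definition epigraph :: "('a \<Rightarrow> ereal) \<Rightarrow> ('a \<times> real) set" where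
  "epigraph f = {(x, \<alpha>). f x \<le> ereal \<alpha>}"

text \<open>Unlike \<^const>\<open>infdist\<close>, the following distance to the empty set is infinite.\<close>

definition ext_dist :: "'a::metric_space \<Rightarrow> 'a set \<Rightarrow> ereal" where
  "ext_dist x S = (INF y\<in>S. ereal (dist x y))"

definition locally_lipschitz_on :: "'a::metric_space set \<Rightarrow> ('a \<Rightarrow> 'b::metric_space) \<Rightarrow> bool" where
  "locally_lipschitz_on S f \<longleftrightarrow> (\<forall>x\<in>S. \<exists>r>0. \<exists>L. L-lipschitz_on (ball x r \<inter> S) f)"

section \<open>Tangent and normal cones, Clarke subdifferential\<close>

definition tangent_cone :: "'a::real_normed_vector set \<Rightarrow> 'a \<Rightarrow> 'a set" where
  "tangent_cone A a = {v. \<exists>t w. (\<forall>n::nat. t n > 0) \<and> t \<longlonglongrightarrow> (0::real) \<and> w \<longlonglongrightarrow> v \<and>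
     (\<forall>n. a + t n *\<^sub>R w n \<in> A)}"

definition frechet_normal_cone :: "'a::real_inner set \<Rightarrow> 'a \<Rightarrow> 'a set" where
  "frechet_normal_cone A a = {v. \<forall>w\<in>tangent_cone A a. v \<bullet> w \<le> 0}"

definition clarke_normal_cone :: "'a::real_inner set \<Rightarrow> 'a \<Rightarrow> 'a set" where
  "clarke_normal_cone A a = closure (convex hull
     {v. \<exists>an vn. (\<forall>n::nat. an n \<in> A \<and> vn n \<in> frechet_normal_cone A (an n)) \<and>
        an \<longlonglongrightarrow> a \<and> vn \<longlonglongrightarrow> v})"

definition clarke_subdiff :: "('a::real_inner \<Rightarrow> ereal) \<Rightarrow> 'a \<Rightarrow> 'a set" where
  "clarke_subdiff f x =
     (if f x < \<infinity>
      then {\<zeta>. (\<zeta>, -1) \<in> clarke_normal_cone (epigraph f) (x, real_of_ereal (f x))}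
      else {})"

definition dom_subdiff :: "('a::real_inner \<Rightarrow> ereal) \<Rightarrow> 'a set" where
  "dom_subdiff f = {x. clarke_subdiff f x \<noteq> {}}"

section \<open>Primal lower regularity and the structured Kurdyka--Lojasiewicz property\<close>

definition plr_at :: "('a::real_inner \<Rightarrow> ereal) \<Rightarrow> 'a \<Rightarrow> bool" where
  "plr_at f xbar \<longleftrightarrow> (\<exists>\<epsilon>>0. \<exists>c\<ge>0. lsc_on (ball xbar \<epsilon>) f \<and>
     (\<forall>x \<in> ball xbar \<epsilon> \<inter> dom_subdiff f. \<forall>\<zeta> \<in> clarke_subdiff f x. \<forall>y \<in> ball xbar \<epsilon>.
        f y \<ge> f x + ereal (\<zeta> \<bullet> (y - x) - c * (1 + norm \<zeta>) * (norm (y - x))\<^sup>2)))"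

definition plr_on :: "'a::real_inner set \<Rightarrow> ('a \<Rightarrow> ereal) \<Rightarrow> bool" where
  "plr_on \<Omega> f \<longleftrightarrow> (\<forall>x\<in>\<Omega>. plr_at f x)"

text \<open>The sum of subdifferentials is the Minkowski sum; it is empty if a summand is, and then the
  distance is infinite.\<close>

definition structured_KL ::
    "('a::real_inner \<Rightarrow> ereal) \<Rightarrow> ('a \<Rightarrow> ereal) \<Rightarrow> 'a \<Rightarrow> bool" where
  "structured_KL \<phi>1 \<phi>2 xstar \<longleftrightarrow>
     (let \<phi> = (\<lambda>x. \<phi>1 x + \<phi>2 x) in
      \<exists>\<eta>>0. \<exists>\<psi> \<psi>'.
        continuous_on {0..\<eta>} \<psi> \<and> concave_on {0..\<eta>} \<psi> \<and> (\<forall>s\<in>{0..\<eta>}. \<psi> s \<ge> 0) \<and> \<psi> 0 = 0 \<and>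
        (\<forall>s\<in>{0<..<\<eta>}. (\<psi> has_real_derivative \<psi>' s) (at s) \<and> \<psi>' s > 0) \<and>
        continuous_on {0<..<\<eta>} \<psi>' \<and>
        (\<forall>x \<in> ball xstar \<eta>. \<phi> xstar < \<phi> x \<and> \<phi> x < \<phi> xstar + ereal \<eta> \<longrightarrow>
           ereal (\<psi>' (real_of_ereal (\<phi> x - \<phi> xstar))) *
             ext_dist 0 (clarke_subdiff \<phi>1 x + clarke_subdiff \<phi>2 x) \<ge> 1))"

section \<open>Graphical derivative and solutions\<close>

definition graphical_deriv ::
    "('a::real_normed_vector \<Rightarrow> 'b::real_normed_vector) \<Rightarrow> 'a \<Rightarrow> 'a \<Rightarrow> 'b set" where
  "graphical_deriv F x v = {u. (v, u) \<in> tangent_cone {(y, z). z = F y} (x, F x)}"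

definition abs_continuous_on :: "real \<Rightarrow> real \<Rightarrow> (real \<Rightarrow> 'a::metric_space) \<Rightarrow> bool" where
  "abs_continuous_on c d f \<longleftrightarrow> (\<forall>\<epsilon>>0. \<exists>\<delta>>0. \<forall>(n::nat) a b.
     (\<forall>i<n. c \<le> a i \<and> a i \<le> b i \<and> b i \<le> d) \<and>
     (\<forall>i<n. \<forall>j<n. i \<noteq> j \<longrightarrow> {a i<..<b i} \<inter> {a j<..<b j} = {}) \<and>
     (\<Sum>i<n. b i - a i) < \<delta> \<longrightarrow> (\<Sum>i<n. dist (f (a i)) (f (b i))) < \<epsilon>)"

definition L2_loc :: "(real \<Rightarrow> 'a::euclidean_space) \<Rightarrow> bool" where
  "L2_loc v \<longleftrightarrow> set_borel_measurable lebesgue {0..} v \<and>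
     (\<forall>T\<ge>0. set_integrable lebesgue {0..T} (\<lambda>t. (norm (v t))\<^sup>2))"

text \<open>Trajectories are functions on all of \<^typ>\<open>real\<close> of which only the values at nonnegative
  times matter. The inclusion at time \<open>t\<close> presupposes that the derivative exists at \<open>t\<close>; for an
  absolutely continuous trajectory this holds almost everywhere, so it is no extra requirement.\<close>

definition is_solution ::
    "('a::euclidean_space \<Rightarrow> ereal) \<Rightarrow> ('a \<Rightarrow> ereal) \<Rightarrow> ('a \<Rightarrow> 'a) \<Rightarrow> 'a \<Rightarrow> (real \<Rightarrow> 'a) \<Rightarrow> bool" where
  "is_solution \<phi>1 \<phi>2 F x0 x \<longleftrightarrow>
     x 0 = x0 \<and>
     (\<forall>c d. 0 \<le> c \<and> c \<le> d \<longrightarrow> abs_continuous_on c d x) \<and>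
     (\<exists>v w. L2_loc v \<and> L2_loc w \<and>
        (AE t in lebesgue. t \<ge> 0 \<longrightarrow>
           v t \<in> clarke_subdiff \<phi>1 (x t) \<and> w t \<in> clarke_subdiff \<phi>2 (x t) \<and>
           (\<exists>x'. (x has_vector_derivative x') (at t) \<and>
                 v t + w t \<in> uminus ` graphical_deriv F (x t) x')))"

text \<open>The nonnegative integral is used so that a derivative that is not square integrable gives an
  infinite left-hand side instead of the default value 0 of the Bochner integral. Taking \<open>s = 0\<close>
  shows that all values along the trajectory are finite when the initial one is, so the indefinite
  difference of two infinities does not occur.\<close>

definition is_energetic_solution ::
    "('a::euclidean_space \<Rightarrow> ereal) \<Rightarrow> ('a \<Rightarrow> ereal) \<Rightarrow> ('a \<Rightarrow> 'a) \<Rightarrow> 'a \<Rightarrow> (real \<Rightarrow> 'a) \<Rightarrow> bool" where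
  "is_energetic_solution \<phi>1 \<phi>2 F x0 x \<longleftrightarrow>
     is_solution \<phi>1 \<phi>2 F x0 x \<and>
     (\<exists>\<rho>>0. \<forall>s t. 0 \<le> s \<and> s < t \<longrightarrow>
        ereal \<rho> * enn2ereal (\<integral>\<^sup>+\<tau>\<in>{s..t}. ennreal ((norm (vector_derivative x (at \<tau>)))\<^sup>2) \<partial>lebesgue)
          \<le> (\<phi>1 (x s) + \<phi>2 (x s)) - (\<phi>1 (x t) + \<phi>2 (x t)))"

definition omega_limit :: "(real \<Rightarrow> 'a::topological_space) \<Rightarrow> 'a set" where
  "omega_limit x = {z. \<exists>tn. (\<forall>n. tn n \<ge> 0) \<and> filterlim tn at_top sequentially \<and>
     (\<lambda>n. x (tn n)) \<longlonglongrightarrow> z}"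

end

theory Submission
  imports Defs
begin

text \<open>Let \<open>\<Phi> t = \<phi> (x t)\<close>. The energy inequality makes \<open>\<Phi>\<close> nonincreasing, so lower semicontinuity
  puts \<open>xstar\<close> into the sublevel set of \<open>x0\<close>, hence into \<open>\<Omega>\<close>. As \<open>\<parallel>x'\<parallel>\<^sup>2\<close> is integrable, near times
  \<open>t\<^sub>n\<close> with \<open>x t\<^sub>n \<rightarrow> xstar\<close> there are times at which \<open>x'\<close> is small; there the Lipschitz bounds on
  \<open>F\<close> and \<open>\<phi>2\<close> keep the subgradient of \<open>\<phi>1\<close> bounded, and primal lower regularity yields
  \<open>\<Phi> \<rightarrow> \<phi> xstar\<close>. Moreover the distance in the Kurdyka--Lojasiewicz inequality is at most
  \<open>L \<parallel>x'\<parallel>\<close>. Set \<open>E t = \<rho> \<integral>\<^sub>t\<^sup>\<infinity> \<parallel>x'\<parallel>\<^sup>2\<close>; then \<open>E \<le> \<Phi> - \<phi> xstar\<close>, and \<open>\<psi>'\<close> is nonincreasing, so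
  \<open>1 \<le> \<psi>'(E) L \<parallel>x'\<parallel>\<close> and \<open>-(\<psi> \<circ> E)' = \<rho> \<psi>'(E) \<parallel>x'\<parallel>\<^sup>2 \<ge> (\<rho> / L) \<parallel>x'\<parallel>\<close>. Hence the length travelled
  after time \<open>t\<close> is controlled by \<open>\<psi> (E t) \<rightarrow> 0\<close> as long as the trajectory stays near \<open>xstar\<close>,
  which in turn keeps it there.\<close>

section \<open>Absolutely continuous functions\<close>

text \<open>This brings absolute continuity into the form the gauge integral needs. The intervals of
  a partial division have disjoint interiors, so an enumeration of the division is a finite family
  to which the epsilon-delta condition applies.\<close>

lemma abs_continuous_on_tagged_division:
  fixes f :: "real \<Rightarrow> 'a::real_normed_vector"
  assumes "abs_continuous_on a b f" "e > 0"
  obtains \<delta> where "\<delta> > 0"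
    "\<And>p. p tagged_partial_division_of {a..b} \<Longrightarrow> (\<Sum>(x,K)\<in>p. measure lborel K) < \<delta> \<Longrightarrow>
       (\<Sum>(x,K)\<in>p. norm (f (Sup K) - f (Inf K))) < e"
proof -
  from assms(1)[unfolded abs_continuous_on_def, rule_format, OF assms(2)]
  obtain \<delta> where \<delta>: "\<delta> > 0" and AC: "\<And>(n::nat) u v.
     (\<forall>i<n. a \<le> u i \<and> u i \<le> v i \<and> v i \<le> b) \<and>
     (\<forall>i<n. \<forall>j<n. i \<noteq> j \<longrightarrow> {u i<..<v i} \<inter> {u j<..<v j} = {}) \<and>
     (\<Sum>i<n. v i - u i) < \<delta> \<Longrightarrow> (\<Sum>i<n. dist (f (u i)) (f (v i))) < e"
    by (elim exE conjE) (rule that, assumption, blast)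
  show ?thesis
  proof (rule that[OF \<delta>])
    fix p assume p: "p tagged_partial_division_of {a..b}" and lt: "(\<Sum>(x,K)\<in>p. measure lborel K) < \<delta>"
    have "finite p" using p unfolding tagged_partial_division_of_def by simp
    then obtain h n where h: "bij_betw h {..<n::nat} p"
      by (metis ex_bij_betw_nat_finite atLeast0LessThan)
    define u where "u i = Inf (snd (h i))" for i
    define v where "v i = Sup (snd (h i))" for i
    have hp: "h i \<in> p" if "i < n" for i using h that by (auto simp: bij_betw_def)
    have K: "snd (h i) = {u i..v i}" "u i \<le> v i" "a \<le> u i" "v i \<le> b" if "i < n" for i
    proof -
      have "fst (h i) \<in> snd (h i)" "snd (h i) \<subseteq> {a..b}" "\<exists>l r. snd (h i) = cbox l r"
        using p hp[OF that] unfolding tagged_partial_division_of_def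
        by (metis prod.collapse)+
      then obtain l r where "snd (h i) = {l..r}" "l \<le> r" "a \<le> l" "r \<le> b"
        by (auto simp: box_real)
      then show "snd (h i) = {u i..v i}" "u i \<le> v i" "a \<le> u i" "v i \<le> b"
        by (auto simp: u_def v_def)
    qed
    have disj: "{u i<..<v i} \<inter> {u j<..<v j} = {}" if "i < n" "j < n" "i \<noteq> j" for i j
    proof -
      have "h i \<noteq> h j" using h that by (metis bij_betw_def inj_onD lessThan_iff)
      then have "interior (snd (h i)) \<inter> interior (snd (h j)) = {}"
        using p hp that unfolding tagged_partial_division_of_def by (metis prod.collapse)
      then show ?thesis using K that by (simp add: interior_atLeastAtMost_real)
    qed
    have "(\<Sum>i<n. v i - u i) = (\<Sum>i<n. measure lborel (snd (h i)))"
      using K by (intro sum.cong) auto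
    also have "\<dots> = (\<Sum>z\<in>p. measure lborel (snd z))"
      using sum.reindex_bij_betw[OF h, of "\<lambda>z. measure lborel (snd z)"] by simp
    finally have "(\<Sum>i<n. v i - u i) < \<delta>" using lt by (simp add: split_def)
    then have "(\<Sum>i<n. dist (f (u i)) (f (v i))) < e"
      using K disj by (intro AC conjI) auto
    moreover have "(\<Sum>i<n. dist (f (u i)) (f (v i))) =
        (\<Sum>z\<in>p. norm (f (Sup (snd z)) - f (Inf (snd z))))"
      using sum.reindex_bij_betw[OF h, of "\<lambda>z. norm (f (Sup (snd z)) - f (Inf (snd z)))"]
      by (simp add: u_def v_def dist_norm norm_minus_commute)
    ultimately show "(\<Sum>(x,K)\<in>p. norm (f (Sup K) - f (Inf K))) < e"
      by (simp add: split_def)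
  qed
qed

text \<open>The intervals do not overlap, so their contents add up to the measure of their union. It
  is applied to the intervals tagged in a null set, with \<open>T\<close> an open neighbourhood of
  that set of small measure.\<close>

lemma tagged_partial_division_content_le_measure:
  fixes p :: "(real \<times> real set) set"
  assumes p: "p tagged_partial_division_of S" and sub: "\<And>x K. (x,K) \<in> p \<Longrightarrow> K \<subseteq> T"
    and T: "T \<in> lmeasurable"
  shows "(\<Sum>(x,K)\<in>p. measure lborel K) \<le> measure lebesgue T"
proof -
  have td: "p tagged_division_of \<Union>(snd ` p)"
    using tagged_partial_division_of_Union_self[OF p] .
  have "(\<Sum>(x,K)\<in>p. measure lborel K) = (\<Sum>K\<in>snd ` p. measure lborel K)"
    using sum.over_tagged_division_lemma[OF td, of "\<lambda>K. measure lborel K"] by simp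
  also have "\<dots> = (\<Sum>K\<in>snd ` p. measure lebesgue K)"
  proof (rule sum.cong)
    fix K assume "K \<in> snd ` p"
    then obtain u v where "K = cbox u v"
      using division_ofD(4)[OF division_of_tagged_division[OF td]] by blast
    then show "measure lborel K = measure lebesgue K" by (simp add: measure_completion)
  qed simp
  also have "\<dots> = measure lebesgue (\<Union>(snd ` p))"
    using content_division[OF division_of_tagged_division[OF td]] .
  also have "\<dots> \<le> measure lebesgue T"
  proof (rule measure_mono_fmeasurable[OF _ _ T])
    show "\<Union>(snd ` p) \<subseteq> T" using sub by force
    have "closed (\<Union>(snd ` p))"
      using elementary_bounded division_of_tagged_division[OF td]
      by (metis division_of_finite division_ofD(4,6) closed_Union closed_cbox)
    then show "\<Union>(snd ` p) \<in> sets lebesgue" by simp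
  qed
  finally show ?thesis .
qed

text \<open>The Riemann sum is split by its tags. Outside \<open>N\<close> differentiability
  controls the error of each interval; the intervals tagged in \<open>N\<close> have small total
  length, so absolute continuity makes the sum of their increments small.\<close>

theorem fundamental_theorem_of_calculus_abs_continuous:
  fixes f :: "real \<Rightarrow> 'a::banach"
  assumes ab: "a \<le> b" and AC: "abs_continuous_on a b f" and N: "negligible N"
    and vecd: "\<And>x. x \<in> {a..b} - N \<Longrightarrow> (f has_vector_derivative f' x) (at x within {a..b})"
  shows "(f' has_integral (f b - f a)) {a..b}"
proof -
  define g where "g x = (if x \<in> N then 0 else f' x)" for x
  have "(g has_integral (f b - f a)) {a..b}"
    unfolding has_integral_real
  proof (intro allI impI)
    fix e0 :: real assume "e0 > 0"
    \<comment> \<open>Half of the tolerance \<open>e0\<close> goes to the tags outside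
      \<open>N\<close>, half to those in \<open>N\<close>. The summand 1 covers the case
      \<open>a = b\<close>.\<close>
    define e where "e = e0 / (2 * (b - a + 1))"
    have e: "e > 0" and e0: "e * (b - a) < e0 / 2"
      using \<open>e0 > 0\<close> ab by (auto simp: e_def field_simps)
    obtain \<delta> where "\<delta> > 0" and \<delta>: "\<And>p. p tagged_partial_division_of {a..b} \<Longrightarrow>
        (\<Sum>(x,K)\<in>p. measure lborel K) < \<delta> \<Longrightarrow> (\<Sum>(x,K)\<in>p. norm (f (Sup K) - f (Inf K))) < e0/2"
      using abs_continuous_on_tagged_division[OF AC, of "e0/2"] \<open>e0 > 0\<close> by auto
    obtain U where U: "open U" "N \<subseteq> U" "U - N \<in> lmeasurable"
        "emeasure lebesgue (U - N) < ennreal \<delta>"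
      using sets_lebesgue_outer_open[OF negligible_imp_sets[OF N] \<open>\<delta> > 0\<close>] by blast
    have U_eq: "U = (U - N) \<union> N" using U by auto
    have Um: "U \<in> lmeasurable"
      using U(3) N negligible_imp_measurable U_eq by (metis fmeasurable.Un)
    have "emeasure lebesgue U = emeasure lebesgue (U - N)"
      using U_eq N by (metis U(3) emeasure_Un_null_set fmeasurableD negligible_iff_null_sets)
    then have "measure lebesgue U < \<delta>"
      using U(4) \<open>\<delta> > 0\<close> Um by (metis emeasure_eq_measure2 ennreal_less_iff measure_nonneg)
    have "\<forall>x. \<exists>d>0. x \<in> {a..b} - N \<longrightarrow>
         (\<forall>y\<in>{a..b}. norm (y-x) < d \<longrightarrow> norm (f y - f x - (y-x) *\<^sub>R f' x) \<le> e * norm (y-x))"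
      using vecd[unfolded has_vector_derivative_def has_derivative_within_alt] e
      by (metis zero_less_one)
    then obtain d where d: "\<And>x. 0 < d x" and dx: "\<And>x y. \<lbrakk>x \<in> {a..b}; x \<notin> N; y \<in> {a..b};
         norm (y-x) < d x\<rbrakk> \<Longrightarrow> norm (f y - f x - (y-x) *\<^sub>R f' x) \<le> e * norm (y-x)"
      by (metis DiffI)
    \<comment> \<open>The gauge confines every interval tagged in \<open>N\<close> to
      \<open>U\<close>, whose measure is below \<open>\<delta>\<close>. At such tags
      \<open>g\<close> vanishes, so only the increment of \<open>f\<close> remains to be
      estimated.\<close>
    define \<gamma> where "\<gamma> x = (if x \<in> N then U else ball x (d x))" for x
    show "\<exists>\<gamma>. gauge \<gamma> \<and> (\<forall>\<D>. \<D> tagged_division_of {a..b} \<and> \<gamma> fine \<D> \<longrightarrow>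
             norm ((\<Sum>(x,K)\<in>\<D>. measure lborel K *\<^sub>R g x) - (f b - f a)) < e0)"
    proof (intro exI conjI allI impI)
      show "gauge \<gamma>" using U d by (auto simp: gauge_def \<gamma>_def)
      fix p assume "p tagged_division_of {a..b} \<and> \<gamma> fine p"
      then have p: "p tagged_division_of {a..b}" and fine: "\<gamma> fine p" by auto
      have finp: "finite p" using p by blast
      have ba: "b - a = (\<Sum>(x,K)\<in>p. Sup K - Inf K)" "f b - f a = (\<Sum>(x,K)\<in>p. f(Sup K) - f(Inf K))"
        using additive_tagged_division_1[where f= "\<lambda>x. x"] additive_tagged_division_1[where f= f]
              \<open>a \<le> b\<close> p by auto
      define q where "q = {z \<in> p. fst z \<in> N}"
      have qp: "q \<subseteq> p" by (auto simp: q_def)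
      have q: "q tagged_partial_division_of {a..b}"
        using tagged_partial_division_subset[OF _ qp] p tagged_division_of_def by blast
      have "(\<Sum>(x,K)\<in>q. measure lborel K) \<le> measure lebesgue U"
        using fine by (intro tagged_partial_division_content_le_measure[OF q _ Um])
          (force simp: q_def fine_def \<gamma>_def)
      then have qlt: "(\<Sum>(x,K)\<in>q. norm (f (Sup K) - f (Inf K))) < e0/2"
        using \<delta>[OF q] \<open>measure lebesgue U < \<delta>\<close> by linarith
      have *: "norm (measure lborel K *\<^sub>R g x - (f (Sup K) - f (Inf K)))
           \<le> e * (Sup K - Inf K) + (if x \<in> N then norm (f (Sup K) - f (Inf K)) else 0)"
        if xK: "(x,K) \<in> p" for x K
      proof -
        obtain u v where k: "K = {u..v}" and "x \<in> K" and kab: "K \<subseteq> {a..b}"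
          using p xK by (metis tagged_division_ofD(2,3,4) box_real(2))
        have uv: "u \<le> v" "u \<in> K" "v \<in> K" using \<open>x \<in> K\<close> unfolding k by auto
        show ?thesis
        proof (cases "x \<in> N")
          case True
          then show ?thesis using uv e by (simp add: g_def k norm_minus_commute)
        next
          case False
          have ball: "y \<in> ball x (d x)" if "y \<in> K" for y
            using fine xK that False by (force simp: fine_def \<gamma>_def)
          \<comment> \<open>Both endpoints are expanded at the tag \<open>x\<close>. Since
            \<open>x\<close> lies between them, the two error terms add up to
            \<open>e * (v - u)\<close>.\<close>
          have "norm ((v - u) *\<^sub>R f' x - (f v - f u)) = norm (f u - f x - (u - x) *\<^sub>R f' x - (f v - f x - (v - x) *\<^sub>R f' x))"
            by (auto simp: algebra_simps)
          also have "\<dots> \<le> norm (f u - f x - (u - x) *\<^sub>R f' x) + norm (f v - f x - (v - x) *\<^sub>R f' x)"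
            by (rule norm_triangle_ineq4)
          also have "\<dots> \<le> e * norm (u - x) + e * norm (v - x)"
          proof (rule add_mono)
            show "norm (f u - f x - (u - x) *\<^sub>R f' x) \<le> e * norm (u - x)"
              using ball[OF uv(2)] uv \<open>x \<in> K\<close> kab False by (intro dx) (auto simp: dist_real_def)
            show "norm (f v - f x - (v - x) *\<^sub>R f' x) \<le> e * norm (v - x)"
              using ball[OF uv(3)] uv \<open>x \<in> K\<close> kab False by (intro dx) (auto simp: dist_real_def)
          qed
          also have "\<dots> = e * (v - u)"
            using \<open>x \<in> K\<close> by (auto simp: k algebra_simps)
          finally show ?thesis using uv False by (simp add: k g_def)
        qed
      qed
      have "norm ((\<Sum>(x,K)\<in>p. measure lborel K *\<^sub>R g x) - (f b - f a))
          = norm (\<Sum>(x,K)\<in>p. measure lborel K *\<^sub>R g x - (f (Sup K) - f (Inf K)))"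
        by (simp add: ba split_def sum_subtractf)
      also have "\<dots> \<le> (\<Sum>(x,K)\<in>p. e * (Sup K - Inf K) +
            (if x \<in> N then norm (f (Sup K) - f (Inf K)) else 0))"
        using * by (intro sum_norm_le) auto
      also have "\<dots> = e * (b - a) + (\<Sum>(x,K)\<in>q. norm (f (Sup K) - f (Inf K)))"
        using finp by (simp add: ba split_def sum.distrib sum_distrib_left q_def sum.inter_filter)
      also have "\<dots> < e0" using e0 qlt by linarith
      finally show "norm ((\<Sum>(x,K)\<in>p. measure lborel K *\<^sub>R g x) - (f b - f a)) < e0" .
    qed
  qed
  then show ?thesis
    by (rule has_integral_spike[OF N, rotated]) (simp add: g_def)
qed

section \<open>Bounds on subgradients and graphical derivatives\<close>

text \<open>Along \<open>h\<close> the function grows at rate at most \<open>K * norm h\<close>, so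
  a ray of at least that slope stays in the epigraph for a short time. A constant sequence of
  directions is therefore a witness.\<close>

lemma tangent_cone_epigraph_lipschitz:
  fixes f :: "'a::real_normed_vector \<Rightarrow> real"
  assumes K: "K-lipschitz_on (ball x r) f" and y: "y \<in> ball x r"
    and epi: "(y, \<beta>) \<in> epigraph (\<lambda>z. ereal (f z))" and \<gamma>: "K * norm h \<le> \<gamma>"
  shows "(h, \<gamma>) \<in> tangent_cone (epigraph (\<lambda>z. ereal (f z))) (y, \<beta>)"
proof -
  \<comment> \<open>Steps up to \<open>c\<close> keep \<open>y + t n *\<^sub>R h\<close> inside the
    ball; the summand 1 avoids division by zero at \<open>h = 0\<close>.\<close>
  define c where "c = (r - dist x y) / (norm h + 1)"
  have c: "c > 0" using y by (simp add: c_def add_nonneg_pos)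
  have ch: "c * norm h < r - dist x y"
  proof -
    have "c * norm h < c * (norm h + 1)" using c by simp
    also have "\<dots> = r - dist x y"
      by (simp add: c_def add_nonneg_eq_0_iff add_eq_0_iff)
        (smt (verit) norm_ge_zero)
    finally show ?thesis .
  qed
  define t where "t n = c * inverse (real (Suc n))" for n
  have tpos: "t n > 0" and tle: "t n \<le> c" for n
    using c by (auto simp: t_def field_simps)
  have "(\<lambda>n. c * inverse (real (Suc n))) \<longlonglongrightarrow> c * 0"
    by (intro tendsto_intros LIMSEQ_inverse_real_of_nat)
  then have tlim: "t \<longlonglongrightarrow> 0" unfolding t_def by simp
  have mem: "(y, \<beta>) + t n *\<^sub>R (h, \<gamma>) \<in> epigraph (\<lambda>z. ereal (f z))" for n
  proof -
    have "dist x (y + t n *\<^sub>R h) \<le> dist x y + dist y (y + t n *\<^sub>R h)" by (rule dist_triangle)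
    also have "dist y (y + t n *\<^sub>R h) = t n * norm h" using tpos[of n] by (simp add: dist_norm)
    also have "\<dots> \<le> c * norm h" using tle by (simp add: mult_right_mono)
    finally have "y + t n *\<^sub>R h \<in> ball x r" using ch by simp
    then have "dist (f (y + t n *\<^sub>R h)) (f y) \<le> K * dist (y + t n *\<^sub>R h) y"
      using K y by (intro lipschitz_onD)
    then have "f (y + t n *\<^sub>R h) - f y \<le> t n * (K * norm h)"
      using tpos[of n] by (simp add: dist_norm algebra_simps)
    also have "\<dots> \<le> t n * \<gamma>" using \<gamma> tpos[of n] by simp
    finally show ?thesis using epi by (simp add: epigraph_def)
  qed
  show ?thesis
    unfolding tangent_cone_def using tpos tlim mem
    by (intro CollectI exI[of _ t] exI[of _ "\<lambda>n. (h, \<gamma>)"]) simp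
qed

text \<open>Two tangent directions suffice: the vertical one gives \<open>q \<le> 0\<close>, and
  \<open>(p, K * norm p)\<close> gives the estimate after division by \<open>norm p\<close>.\<close>

lemma frechet_normal_cone_epigraph_lipschitz:
  fixes f :: "'a::real_inner \<Rightarrow> real"
  assumes K: "K-lipschitz_on (ball x r) f" and y: "y \<in> ball x r"
    and epi: "(y, \<beta>) \<in> epigraph (\<lambda>z. ereal (f z))"
    and pq: "(p, q) \<in> frechet_normal_cone (epigraph (\<lambda>z. ereal (f z))) (y, \<beta>)"
  shows "norm p \<le> - q * K"
proof -
  have n: "(p, q) \<bullet> (h, \<gamma>) \<le> 0" if "K * norm h \<le> \<gamma>" for h \<gamma>
    using tangent_cone_epigraph_lipschitz[OF K y epi that] pq
    unfolding frechet_normal_cone_def by blast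
  have "q \<le> 0" using n[of 0 1] by simp
  have "(p, q) \<bullet> (p, K * norm p) \<le> 0" by (rule n) simp
  then have *: "norm p * (norm p + q * K) \<le> 0"
    by (simp add: power2_norm_eq_inner[symmetric] power2_eq_square algebra_simps)
  show ?thesis
  proof (cases "p = 0")
    case True
    then show ?thesis using \<open>q \<le> 0\<close> lipschitz_on_nonneg[OF K]
      by (simp add: mult_nonpos_nonneg)
  next
    case False
    then show ?thesis using * by (simp add: mult_le_0_iff)
  qed
qed

text \<open>The bound on Frechet normals describes a closed convex cone \<open>C\<close>. It
  therefore survives limits of normals at nearby points, convex combinations and closure; setting
  \<open>q = -1\<close> turns it into the bound by \<open>K\<close>.\<close>

lemma norm_clarke_subdiff_le_lipschitz:
  fixes f :: "'a::real_inner \<Rightarrow> real"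
  assumes K: "K-lipschitz_on (ball x r) f" and r: "r > 0"
    and \<zeta>: "\<zeta> \<in> clarke_subdiff (\<lambda>z. ereal (f z)) x"
  shows "norm \<zeta> \<le> K"
proof -
  define C where "C = {(p::'a, q::real). norm p \<le> - q * K}"
  have "closed C" unfolding C_def split_def by (intro closed_Collect_le continuous_intros)
  moreover have "convex C"
    unfolding convex_def C_def
  proof clarsimp
    fix p1 p2 :: 'a and q1 q2 u v :: real
    assume *: "norm p1 \<le> - (q1 * K)" "norm p2 \<le> - (q2 * K)" "0 \<le> u" "0 \<le> v"
    have "norm (u *\<^sub>R p1 + v *\<^sub>R p2) \<le> norm (u *\<^sub>R p1) + norm (v *\<^sub>R p2)" by (rule norm_triangle_ineq)
    also have "\<dots> = u * norm p1 + v * norm p2" using * by simp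
    also have "\<dots> \<le> u * - (q1 * K) + v * - (q2 * K)"
      using * by (intro add_mono mult_left_mono)
    finally show "norm (u *\<^sub>R p1 + v *\<^sub>R p2) \<le> - ((u * q1 + v * q2) * K)"
      by (simp add: algebra_simps)
  qed
  moreover have "{v. \<exists>an vn. (\<forall>n::nat. an n \<in> epigraph (\<lambda>z. ereal (f z)) \<and>
        vn n \<in> frechet_normal_cone (epigraph (\<lambda>z. ereal (f z))) (an n)) \<and>
        an \<longlonglongrightarrow> (x, f x) \<and> vn \<longlonglongrightarrow> v} \<subseteq> C"
  proof clarify
    fix v1 v2 an vn
    assume an: "\<forall>n::nat. an n \<in> epigraph (\<lambda>z. ereal (f z)) \<and>
        vn n \<in> frechet_normal_cone (epigraph (\<lambda>z. ereal (f z))) (an n)"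
      and lim: "an \<longlonglongrightarrow> (x, f x)" "vn \<longlonglongrightarrow> (v1, v2)"
    have "(\<lambda>n. fst (an n)) \<longlonglongrightarrow> x" using tendsto_fst[OF lim(1)] by simp
    then have "\<forall>\<^sub>F n in sequentially. fst (an n) \<in> ball x r"
      using r by (metis centre_in_ball open_ball topological_tendstoD)
    then have "\<forall>\<^sub>F n in sequentially. vn n \<in> C"
    proof eventually_elim
      case (elim n)
      then show ?case
        using an frechet_normal_cone_epigraph_lipschitz[OF K, of "fst (an n)" "snd (an n)" "fst (vn n)" "snd (vn n)"]
        by (simp add: C_def split_def)
    qed
    then show "(v1, v2) \<in> C"
      using Lim_in_closed_set[OF \<open>closed C\<close> _ _ lim(2)] by simp
  qed
  ultimately have "clarke_normal_cone (epigraph (\<lambda>z. ereal (f z))) (x, f x) \<subseteq> C"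
    unfolding clarke_normal_cone_def by (intro closure_minimal hull_minimal)
  then show ?thesis using \<zeta> by (auto simp: clarke_subdiff_def C_def)
qed

text \<open>A tangent vector to the graph is a limit of difference quotients of \<open>F\<close>,
  each of which obeys the Lipschitz bound once the step \<open>t n\<close> is cancelled.\<close>

lemma norm_graphical_deriv_le_lipschitz:
  fixes F :: "'a::real_normed_vector \<Rightarrow> 'b::real_normed_vector"
  assumes L: "L-lipschitz_on (ball x r) F" and r: "r > 0" and u: "u \<in> graphical_deriv F x v"
  shows "norm u \<le> L * norm v"
proof -
  obtain t w where tpos: "\<And>n::nat. t n > 0" and t: "t \<longlonglongrightarrow> (0::real)" and w: "w \<longlonglongrightarrow> (v, u)"
    and gr: "\<And>n. (x, F x) + t n *\<^sub>R w n \<in> {(y, z). z = F y}"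
    using u unfolding graphical_deriv_def tangent_cone_def by (elim CollectE exE conjE) auto
  have f: "(\<lambda>n. fst (w n)) \<longlonglongrightarrow> v" and s: "(\<lambda>n. snd (w n)) \<longlonglongrightarrow> u"
    using tendsto_fst[OF w] tendsto_snd[OF w] by auto
  have "(\<lambda>n. x + t n *\<^sub>R fst (w n)) \<longlonglongrightarrow> x + 0 *\<^sub>R v" by (intro tendsto_intros t f)
  then have "(\<lambda>n. x + t n *\<^sub>R fst (w n)) \<longlonglongrightarrow> x" by simp
  from topological_tendstoD[OF this open_ball, of x r] r
  have "\<forall>\<^sub>F n in sequentially. x + t n *\<^sub>R fst (w n) \<in> ball x r" by simp
  then have "\<forall>\<^sub>F n in sequentially. norm (snd (w n)) \<le> L * norm (fst (w n))"
  proof eventually_elim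
    case (elim n)
    have "F (x + t n *\<^sub>R fst (w n)) = F x + t n *\<^sub>R snd (w n)"
      using gr[of n] by (cases "w n") simp
    then have "t n * norm (snd (w n)) \<le> t n * (L * norm (fst (w n)))"
      using lipschitz_onD[OF L elim, of x] r tpos[of n] by (simp add: dist_norm algebra_simps)
    then show ?case using tpos[of n] by simp
  qed
  then show ?thesis
    by (intro tendsto_le[OF _ tendsto_mult[OF tendsto_const tendsto_norm[OF f]] tendsto_norm[OF s]]) auto
qed

lemma locally_lipschitz_on_ball:
  assumes "locally_lipschitz_on S f" "open S" "x \<in> S"
  obtains r L where "r > 0" "ball x r \<subseteq> S" "L-lipschitz_on (ball x r) f"
proof -
  obtain r1 L where r1: "r1 > 0" "L-lipschitz_on (ball x r1 \<inter> S) f"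
    using assms unfolding locally_lipschitz_on_def by blast
  obtain r2 where r2: "r2 > 0" "ball x r2 \<subseteq> S" using assms by (meson open_contains_ball)
  show ?thesis
  proof
    show "min r1 r2 > 0" "ball x (min r1 r2) \<subseteq> S" using r1 r2 by auto
    show "L-lipschitz_on (ball x (min r1 r2)) f"
      using r1(2) by (rule lipschitz_on_subset) (use r2 in auto)
  qed
qed

section \<open>Finite length under a Kurdyka--Lojasiewicz inequality\<close>

lemma concave_on_le_tangent:
  fixes \<psi> :: "real \<Rightarrow> real"
  assumes "concave_on {0..\<eta>} \<psi>" and "\<And>s. s \<in> {0<..<\<eta>} \<Longrightarrow> (\<psi> has_real_derivative \<psi>' s) (at s)"
    and "a \<in> {0<..<\<eta>}" "b \<in> {0<..<\<eta>}"
  shows "\<psi> b - \<psi> a \<le> \<psi>' a * (b - a)"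
proof -
  have "convex_on {0..\<eta>} (\<lambda>s. - \<psi> s)" using assms(1) by (simp add: concave_on_def)
  moreover have "((\<lambda>s. - \<psi> s) has_real_derivative - \<psi>' a) (at a within {0..\<eta>})"
    using assms(2)[OF assms(3)] by (intro DERIV_minus) (rule has_field_derivative_at_within)
  ultimately have "- \<psi> b - - \<psi> a \<ge> - \<psi>' a * (b - a)"
    using assms(3,4) by (intro convex_on_imp_above_tangent) (auto simp: interior_atLeastAtMost_real)
  then show ?thesis by simp
qed

text \<open>Adding the tangent inequalities at \<open>a\<close> and at \<open>b\<close> cancels the
  values of \<open>\<psi>\<close>.\<close>

lemma concave_on_deriv_antimono:
  fixes \<psi> :: "real \<Rightarrow> real"
  assumes "concave_on {0..\<eta>} \<psi>" and "\<And>s. s \<in> {0<..<\<eta>} \<Longrightarrow> (\<psi> has_real_derivative \<psi>' s) (at s)"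
    and "0 < a" "a \<le> b" "b < \<eta>"
  shows "\<psi>' b \<le> \<psi>' a"
proof (cases "a = b")
  case False
  have "\<psi> b - \<psi> a \<le> \<psi>' a * (b - a)" "\<psi> a - \<psi> b \<le> \<psi>' b * (a - b)"
    using assms by (auto intro!: concave_on_le_tangent[OF assms(1,2)])
  then have "0 \<le> (\<psi>' a - \<psi>' b) * (b - a)" by (simp add: algebra_simps)
  then show ?thesis using assms(4) False by (simp add: zero_le_mult_iff)
qed simp

lemma integral_le_negligible:
  fixes f g :: "'b::euclidean_space \<Rightarrow> real"
  assumes "f integrable_on S" "g integrable_on S" and M: "negligible M"
    and le: "\<And>x. x \<in> S - M \<Longrightarrow> f x \<le> g x"
  shows "integral S f \<le> integral S g"
proof -
  have "((\<lambda>x. if x \<in> M then g x else f x) has_integral integral S f) S"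
    using integrable_integral[OF assms(1)] by (rule has_integral_spike[OF M, rotated]) simp
  then show ?thesis
    using integrable_integral[OF assms(2)] by (rule has_integral_le) (use le in auto)
qed

text \<open>The pointwise inequality
  \<open>N \<tau> \<le> \<epsilon> + (N \<tau>)\<^sup>2 / \<epsilon>\<close> is integrated. The free
  parameter \<open>\<epsilon>\<close> is matched to the size of the quadratic integral in each
  application.\<close>

lemma integral_norm_le_of_power2:
  fixes N :: "real \<Rightarrow> real"
  assumes "N integrable_on {s..t}" "(\<lambda>\<tau>. (N \<tau>)\<^sup>2) integrable_on {s..t}" "s \<le> t" "\<epsilon> > 0"
  shows "integral {s..t} N \<le> \<epsilon> * (t - s) + integral {s..t} (\<lambda>\<tau>. (N \<tau>)\<^sup>2) / \<epsilon>"
proof -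
  have *: "N \<tau> \<le> \<epsilon> + (N \<tau>)\<^sup>2 / \<epsilon>" for \<tau>
  proof -
    have "\<epsilon> * N \<tau> \<le> \<epsilon>\<^sup>2 + (N \<tau>)\<^sup>2"
      using sum_squares_bound[of \<epsilon> "N \<tau>"] sum_power2_ge_zero[of \<epsilon> "N \<tau>"]
      unfolding mult.assoc by linarith
    then show ?thesis using assms(4) by (simp add: field_simps power2_eq_square)
  qed
  have i: "(\<lambda>\<tau>. (N \<tau>)\<^sup>2 / \<epsilon>) integrable_on {s..t}"
    using assms(2) by (rule integrable_on_divide)
  have "integral {s..t} N \<le> integral {s..t} (\<lambda>\<tau>. \<epsilon> + (N \<tau>)\<^sup>2 / \<epsilon>)"
    using assms * i by (intro integral_le integrable_add) auto
  also have "\<dots> = \<epsilon> * (t - s) + integral {s..t} (\<lambda>\<tau>. (N \<tau>)\<^sup>2) / \<epsilon>"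
    using i assms by (subst integral_add) auto
  finally show ?thesis .
qed

text \<open>On a short interval \<open>\<psi>'\<close> varies by a factor of at most 2 along \<open>E\<close>, which gives the estimate
  there; Bolzano's bisection principle adds the pieces up. This avoids an almost everywhere chain
  rule for \<open>\<psi> \<circ> E\<close>.\<close>

lemma KL_length_estimate:
  fixes N E \<psi> \<psi>' :: "real \<Rightarrow> real"
  assumes ab: "a \<le> b" and L: "L > 0" and \<rho>: "\<rho> > 0"
    and N: "N integrable_on {a..b}" and N2: "(\<lambda>\<tau>. (N \<tau>)\<^sup>2) integrable_on {a..b}"
    and N0: "\<And>t. N t \<ge> 0"
    and E: "\<And>s t. a \<le> s \<Longrightarrow> s \<le> t \<Longrightarrow> t \<le> b \<Longrightarrow> \<rho> * integral {s..t} (\<lambda>\<tau>. (N \<tau>)\<^sup>2) = E s - E t"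
    and E\<eta>: "\<And>t. t \<in> {a..b} \<Longrightarrow> E t \<in> {0<..<\<eta>}"
    and conc: "concave_on {0..\<eta>} \<psi>"
    and der: "\<And>s. s \<in> {0<..<\<eta>} \<Longrightarrow> (\<psi> has_real_derivative \<psi>' s) (at s)"
    and pos: "\<And>s. s \<in> {0<..<\<eta>} \<Longrightarrow> \<psi>' s > 0"
    and cont: "continuous_on {0<..<\<eta>} \<psi>'"
    and M: "negligible M"
    and KL: "\<And>t. t \<in> {a..b} - M \<Longrightarrow> 1 \<le> \<psi>' (E t) * (L * N t)"
  shows "integral {a..b} N \<le> 2 * L / \<rho> * (\<psi> (E a) - \<psi> (E b))"
proof -
  define P where "P u v \<longleftrightarrow> (a \<le> u \<and> u \<le> v \<and> v \<le> b \<longrightarrow>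
      integral {u..v} N \<le> 2 * L / \<rho> * (\<psi> (E u) - \<psi> (E v)))" for u v
  have E_anti: "E t \<le> E s" if "a \<le> s" "s \<le> t" "t \<le> b" for s t
  proof -
    have "(\<lambda>\<tau>. (N \<tau>)\<^sup>2) integrable_on {s..t}"
      using that by (intro integrable_on_subinterval[OF N2]) auto
    then have "0 \<le> \<rho> * integral {s..t} (\<lambda>\<tau>. (N \<tau>)\<^sup>2)"
      using \<rho> by (intro mult_nonneg_nonneg Henstock_Kurzweil_Integration.integral_nonneg) auto
    then show ?thesis using E[OF that] by simp
  qed
  have "continuous_on {a..b} (\<lambda>t. E a - \<rho> * integral {a..t} (\<lambda>\<tau>. (N \<tau>)\<^sup>2))"
    by (intro continuous_intros indefinite_integral_continuous_1 N2)
  then have "continuous_on {a..b} E"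
    by (rule continuous_on_eq) (use E[of a] in auto)
  then have mcont: "continuous_on {a..b} (\<lambda>t. \<psi>' (E t))"
    using E\<eta> by (intro continuous_on_compose2[OF cont]) auto
  have "P a b"
    using ab
  proof (induction a b rule: Bolzano)
    case (trans u v w)
    show ?case unfolding P_def
    proof
      assume uw: "a \<le> u \<and> u \<le> w \<and> w \<le> b"
      have "integral {u..w} N = integral {u..v} N + integral {v..w} N"
        using trans uw by (intro Henstock_Kurzweil_Integration.integral_combine[symmetric]
            integrable_on_subinterval[OF N]) auto
      also have "\<dots> \<le> 2 * L / \<rho> * (\<psi> (E u) - \<psi> (E v)) + 2 * L / \<rho> * (\<psi> (E v) - \<psi> (E w))"
        using trans uw by (intro add_mono) (auto simp: P_def)
      also have "\<dots> = 2 * L / \<rho> * (\<psi> (E u) - \<psi> (E w))" by (simp add: right_diff_distrib)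
      finally show "integral {u..w} N \<le> 2 * L / \<rho> * (\<psi> (E u) - \<psi> (E w))" .
    qed
  next
    case (local \<tau>)
    have mpos: "\<psi>' (E \<tau>) > 0" using local E\<eta> pos by simp
    then obtain d where d: "d > 0"
      "\<And>t. t \<in> {a..b} \<Longrightarrow> dist t \<tau> < d \<Longrightarrow> dist (\<psi>' (E t)) (\<psi>' (E \<tau>)) < \<psi>' (E \<tau>) / 3"
      using mcont local unfolding continuous_on_iff
      by (metis atLeastAtMost_iff divide_pos_pos zero_less_numeral)
    have "P u v" if uv: "u \<le> \<tau>" "\<tau> \<le> v" "v - u < d" for u v
      unfolding P_def
    proof
      assume ab': "a \<le> u \<and> u \<le> v \<and> v \<le> b"
      have "dist (\<psi>' (E u)) (\<psi>' (E \<tau>)) < \<psi>' (E \<tau>) / 3"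
        by (rule d(2)) (use uv ab' in \<open>auto simp: dist_real_def\<close>)
      moreover have "dist (\<psi>' (E v)) (\<psi>' (E \<tau>)) < \<psi>' (E \<tau>) / 3"
        by (rule d(2)) (use uv ab' in \<open>auto simp: dist_real_def\<close>)
      \<comment> \<open>The value at \<open>v\<close> is below 4/3 and the value at \<open>u\<close>
        above 2/3 of \<open>\<psi>' (E \<tau>)\<close>.\<close>
      ultimately have m2: "\<psi>' (E v) \<le> 2 * \<psi>' (E u)" unfolding dist_real_def by linarith
      have Eu: "E u \<in> {0<..<\<eta>}" and Ev: "E v \<in> {0<..<\<eta>}" using E\<eta> ab' by auto
      \<comment> \<open>\<open>E\<close> is smallest at \<open>v\<close>, so
        \<open>\<psi>' (E v)\<close> bounds \<open>\<psi>' (E t)\<close> on the whole piece.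
        Multiplying the Kurdyka--Lojasiewicz inequality by \<open>N t\<close> then gives an
        integrand proportional to the dissipation.\<close>
      have "integral {u..v} N \<le> integral {u..v} (\<lambda>t. L * \<psi>' (E v) * (N t)\<^sup>2)"
      proof (rule integral_le_negligible)
        show "N integrable_on {u..v}" using ab' by (auto intro: integrable_on_subinterval[OF N])
        show "(\<lambda>t. L * \<psi>' (E v) * (N t)\<^sup>2) integrable_on {u..v}"
          using ab' by (intro integrable_on_mult_right integrable_on_subinterval[OF N2]) auto
        show "negligible M" by (rule M)
        fix t assume t: "t \<in> {u..v} - M"
        have "\<psi>' (E t) \<le> \<psi>' (E v)"
          using t ab' E\<eta>[of t] E\<eta>[of v] E_anti[of t v]
          by (intro concave_on_deriv_antimono[OF conc der]) auto
        then have "\<psi>' (E t) * (L * N t) \<le> \<psi>' (E v) * (L * N t)"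
          using L N0[of t] by (intro mult_right_mono) auto
        then have "1 \<le> \<psi>' (E v) * (L * N t)" using KL[of t] t ab' by auto
        then have "1 * N t \<le> \<psi>' (E v) * (L * N t) * N t" using N0 by (intro mult_right_mono)
        then show "N t \<le> L * \<psi>' (E v) * (N t)\<^sup>2" by (simp add: power2_eq_square algebra_simps)
      qed
      also have "\<dots> = L / \<rho> * \<psi>' (E v) * (E u - E v)"
        using E[of u v, symmetric] ab' \<rho> by simp
      \<comment> \<open>The slope is moved from \<open>E v\<close> to \<open>E u\<close> at the cost
        of the factor 2, because concavity bounds \<open>\<psi> (E u) - \<psi> (E v)\<close> from
        below only by means of the tangent at \<open>E u\<close>.\<close>
      also have "\<dots> \<le> L / \<rho> * (2 * \<psi>' (E u)) * (E u - E v)"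
        using m2 L \<rho> E_anti[of u v] ab' by (intro mult_right_mono mult_left_mono) auto
      also have "\<dots> = 2 * L / \<rho> * (\<psi>' (E u) * (E u - E v))" by simp
      also have "\<dots> \<le> 2 * L / \<rho> * (\<psi> (E u) - \<psi> (E v))"
        using concave_on_le_tangent[OF conc der Eu Ev] L \<rho>
        by (intro mult_left_mono) (auto simp: algebra_simps)
      finally show "integral {u..v} N \<le> 2 * L / \<rho> * (\<psi> (E u) - \<psi> (E v))" .
    qed
    then show ?case using d(1) by blast
  qed
  then show ?thesis using ab by (simp add: P_def)
qed

text \<open>Monotone convergence of the truncations \<open>g k\<close> makes the norm integrable on
  the half-line, and the norm then dominates \<open>f\<close>.\<close>

lemma absolutely_integrable_on_Ici_bounded:
  fixes f :: "real \<Rightarrow> 'a::euclidean_space"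
  assumes f: "\<And>T. f integrable_on {0..T}" and n: "\<And>T. (\<lambda>t. norm (f t)) integrable_on {0..T}"
    and B: "\<And>T. T \<ge> 0 \<Longrightarrow> integral {0..T} (\<lambda>t. norm (f t)) \<le> B"
  shows "f absolutely_integrable_on {0..}"
proof -
  define g where "g k t = (if t \<in> {0..real k} then norm (f t) else 0)" for k t
  have gi: "g k integrable_on {0..}" and gI: "integral {0..} (g k) = integral {0..real k} (\<lambda>t. norm (f t))" for k
    unfolding g_def integrable_restrict_Int integral_restrict_Int using n[of "real k"]
    by (simp_all add: Int_absorb2)
  have ni: "(\<lambda>t. norm (f t)) integrable_on {0..}"
  proof (rule conjunct1[OF monotone_convergence_increasing[of g]])
    show "g k integrable_on {0..}" for k by (rule gi)
    show "g k t \<le> g (Suc k) t" for k t by (auto simp: g_def)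
    show "(\<lambda>k. g k t) \<longlonglongrightarrow> norm (f t)" if "t \<in> {0..}" for t
    proof (rule tendsto_eventually)
      obtain k0 :: nat where "t \<le> real k0" using real_arch_simple by blast
      then show "\<forall>\<^sub>F k in sequentially. g k t = norm (f t)"
        using that by (intro eventually_sequentiallyI[of k0]) (auto simp: g_def)
    qed
    show "bounded (range (\<lambda>k. integral {0..} (g k)))"
      unfolding bounded_iff gI
      by (intro exI[of _ B])
        (auto intro!: B simp: Henstock_Kurzweil_Integration.integral_nonneg n)
  qed
  have "f integrable_on {0..}"
  proof (rule integrable_on_all_intervals_integrable_bound[OF _ _ ni])
    show "(\<lambda>t. if t \<in> {0..} then f t else 0) integrable_on cbox a b" for a b
    proof -
      have *: "{0..} \<inter> {a..b} = {max a 0..b}" by auto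
      show ?thesis unfolding integrable_restrict_Int box_real *
        using f[of b] by (rule integrable_on_subinterval) auto
    qed
  qed auto
  then show ?thesis using ni by (rule absolutely_integrable_onI)
qed

lemma dist_le_integral_norm:
  fixes x D :: "real \<Rightarrow> 'a::euclidean_space"
  assumes "(D has_integral (x t - x s)) {s..t}" "(\<lambda>\<tau>. norm (D \<tau>)) integrable_on {s..t}"
  shows "dist (x s) (x t) \<le> integral {s..t} (\<lambda>\<tau>. norm (D \<tau>))"
  using integral_norm_bound_integral[OF has_integral_integrable[OF assms(1)] assms(2)]
  by (simp add: dist_norm norm_minus_commute integral_unique[OF assms(1)])

text \<open>Displacement is at most length, so small tails give both a finite total length and the
  Cauchy property. The omega-limit point identifies the limit.\<close>

lemma converges_of_small_tails:
  fixes x :: "real \<Rightarrow> 'a::euclidean_space"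
  assumes ftc: "\<And>s t. 0 \<le> s \<Longrightarrow> s \<le> t \<Longrightarrow> (D has_integral (x t - x s)) {s..t}"
    and Ni: "\<And>s t. 0 \<le> s \<Longrightarrow> (\<lambda>\<tau>. norm (D \<tau>)) integrable_on {s..t}"
    and om: "xs \<in> omega_limit x"
    and H: "\<And>\<epsilon>. \<epsilon> > 0 \<Longrightarrow> \<exists>t0\<ge>0. \<forall>T\<ge>t0. integral {t0..T} (\<lambda>\<tau>. norm (D \<tau>)) \<le> \<epsilon>"
  shows "D absolutely_integrable_on {0..} \<and> (x \<longlongrightarrow> xs) at_top"
proof
  have len: "dist (x s) (x t) \<le> integral {s..t} (\<lambda>\<tau>. norm (D \<tau>))" if "0 \<le> s" "s \<le> t" for s t
    by (rule dist_le_integral_norm[OF ftc[OF that] Ni[OF that(1)]])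
  have N0: "0 \<le> integral {s..t} (\<lambda>\<tau>. norm (D \<tau>))" if "0 \<le> s" for s t
    using that by (intro Henstock_Kurzweil_Integration.integral_nonneg Ni) auto
  obtain t0 where t0: "t0 \<ge> 0" "\<And>T. T \<ge> t0 \<Longrightarrow> integral {t0..T} (\<lambda>\<tau>. norm (D \<tau>)) \<le> 1"
    using H[of 1] by auto
  show "D absolutely_integrable_on {0..}"
  proof (rule absolutely_integrable_on_Ici_bounded)
    show "D integrable_on {0..T}" for T
      using ftc[of 0 T] by (cases "0 \<le> T") auto
    show "(\<lambda>t. norm (D t)) integrable_on {0..T}" for T by (simp add: Ni)
    show "integral {0..T} (\<lambda>t. norm (D t)) \<le> integral {0..t0} (\<lambda>t. norm (D t)) + 1" if "T \<ge> 0" for T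
    proof (cases "T \<le> t0")
      case True
      then have "integral {0..T} (\<lambda>t. norm (D t)) \<le> integral {0..t0} (\<lambda>t. norm (D t))"
        using that by (intro integral_subset_le Ni) auto
      then show ?thesis by simp
    next
      case False
      then have "integral {0..T} (\<lambda>t. norm (D t)) = integral {0..t0} (\<lambda>t. norm (D t)) + integral {t0..T} (\<lambda>t. norm (D t))"
        using t0 by (intro Henstock_Kurzweil_Integration.integral_combine[symmetric] Ni) auto
      then show ?thesis using t0(2)[of T] False by simp
    qed
  qed
  show "(x \<longlongrightarrow> xs) at_top"
  proof (rule tendstoI)
    fix e :: real assume e: "e > 0"
    obtain t0 where t0: "t0 \<ge> 0" "\<And>T. T \<ge> t0 \<Longrightarrow> integral {t0..T} (\<lambda>\<tau>. norm (D \<tau>)) \<le> e / 3"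
      using H[of "e/3"] e by auto
    obtain tn where tn: "filterlim tn at_top sequentially" "(\<lambda>n. x (tn n)) \<longlonglongrightarrow> xs"
      using om by (auto simp: omega_limit_def)
    have "\<forall>\<^sub>F n in sequentially. t0 \<le> tn n \<and> dist (x (tn n)) xs < e / 3"
      using tn(1)[unfolded filterlim_at_top] tendstoD[OF tn(2), of "e/3"] e
      by (auto intro: eventually_conj)
    then obtain n where n: "t0 \<le> tn n" "dist (x (tn n)) xs < e / 3"
      using eventually_happens by force
    \<comment> \<open>The path from \<open>x T\<close> to \<open>xs\<close> passes through
      \<open>x t0\<close> and \<open>x (tn n)\<close>, with a third of \<open>e\<close> for each
      leg.\<close>
    have "dist (x T) xs < e" if T: "T \<ge> t0" for T
    proof -
      have "dist (x t0) (x T) \<le> e/3" "dist (x t0) (x (tn n)) \<le> e/3"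
        using len[OF t0(1) T] len[OF t0(1) n(1)] t0(2)[OF T] t0(2)[OF n(1)] by auto
      then show ?thesis
        using n(2) dist_triangle[of "x T" xs "x t0"] dist_triangle[of "x t0" xs "x (tn n)"]
        by (simp add: dist_commute)
    qed
    then show "\<forall>\<^sub>F t in at_top. dist (x t) xs < e"
      using eventually_ge_at_top[of t0] by (rule eventually_mono[rotated])
  qed
qed

text \<open>With \<open>E t\<close> the energy still to be dissipated after time \<open>t\<close>, \<open>E \<le> \<Phi> - \<Phi>s\<close>, so that the
  inequality survives the replacement of \<open>\<Phi> - \<Phi>s\<close> by \<open>E\<close>; unlike \<open>\<Phi>\<close>, which may jump, \<open>E\<close> is
  continuous.\<close>

theorem KL_convergence:
  fixes x D :: "real \<Rightarrow> 'a::euclidean_space" and \<Phi> \<psi> \<psi>' :: "real \<Rightarrow> real"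
  assumes ftc: "\<And>s t. 0 \<le> s \<Longrightarrow> s \<le> t \<Longrightarrow> (D has_integral (x t - x s)) {s..t}"
    and Ni: "\<And>s t. 0 \<le> s \<Longrightarrow> (\<lambda>\<tau>. norm (D \<tau>)) integrable_on {s..t}"
    and N2: "\<And>s t. 0 \<le> s \<Longrightarrow> (\<lambda>\<tau>. (norm (D \<tau>))\<^sup>2) integrable_on {s..t}"
    and \<rho>: "\<rho> > 0"
    and en: "\<And>s t. 0 \<le> s \<Longrightarrow> s \<le> t \<Longrightarrow> \<rho> * integral {s..t} (\<lambda>\<tau>. (norm (D \<tau>))\<^sup>2) \<le> \<Phi> s - \<Phi> t"
    and \<Phi>s: "\<And>t. t \<ge> 0 \<Longrightarrow> \<Phi>s \<le> \<Phi> t" and lim: "(\<Phi> \<longlongrightarrow> \<Phi>s) at_top"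
    and om: "xs \<in> omega_limit x"
    and \<eta>: "\<eta> > 0" and contp: "continuous_on {0..\<eta>} \<psi>" and conc: "concave_on {0..\<eta>} \<psi>"
    and \<psi>0: "\<psi> 0 = 0" and \<psi>nn: "\<And>s. s \<in> {0..\<eta>} \<Longrightarrow> \<psi> s \<ge> 0"
    and der: "\<And>s. s \<in> {0<..<\<eta>} \<Longrightarrow> (\<psi> has_real_derivative \<psi>' s) (at s)"
    and pos: "\<And>s. s \<in> {0<..<\<eta>} \<Longrightarrow> \<psi>' s > 0"
    and cont: "continuous_on {0<..<\<eta>} \<psi>'"
    and M: "negligible M" and L: "L > 0" and r: "r > 0"
    and KL: "\<And>t. t \<ge> 0 \<Longrightarrow> t \<notin> M \<Longrightarrow> x t \<in> ball xs r \<Longrightarrow> \<Phi>s < \<Phi> t \<Longrightarrow> \<Phi> t < \<Phi>s + \<eta> \<Longrightarrow>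
        1 \<le> \<psi>' (\<Phi> t - \<Phi>s) * (L * norm (D t))"
  shows "D absolutely_integrable_on {0..} \<and> (x \<longlongrightarrow> xs) at_top"
proof (rule converges_of_small_tails[OF ftc Ni om])
  define S where "S t = integral {0..t} (\<lambda>\<tau>. (norm (D \<tau>))\<^sup>2)" for t
  \<comment> \<open>The supremum of the nondecreasing \<open>S\<close> stands for the integral over
    the half-line. It is a genuine bound because \<open>Sb\<close> makes \<open>S\<close> bounded
    above.\<close>
  define E where "E t = \<rho> * (Sup (S ` {0..}) - S t)" for t
  have Sdiff: "integral {s..t} (\<lambda>\<tau>. (norm (D \<tau>))\<^sup>2) = S t - S s" if "0 \<le> s" "s \<le> t" for s t
    using Henstock_Kurzweil_Integration.integral_combine[OF that N2[of 0 t]] by (simp add: S_def)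
  have Smono: "S s \<le> S t" if "0 \<le> s" "s \<le> t" for s t
    using Sdiff[OF that] Henstock_Kurzweil_Integration.integral_nonneg[OF N2[OF that(1), of t]] by simp
  have Sb: "S T \<le> S t + (\<Phi> t - \<Phi>s) / \<rho>" if "0 \<le> t" "0 \<le> T" for t T
  proof (cases "t \<le> T")
    case True
    have "\<rho> * (S T - S t) \<le> \<Phi> t - \<Phi>s"
      using en[OF that(1) True] Sdiff[OF that(1) True] \<Phi>s[OF that(2)] by simp
    then show ?thesis using \<rho> by (simp add: field_simps)
  next
    case False
    then show ?thesis using Smono[of T t] \<Phi>s[of t] that \<rho>
      by (smt (verit) divide_nonneg_pos)
  qed
  have bdd: "bdd_above (S ` {0..})" using Sb[of 0] by (intro bdd_aboveI[of _ "S 0 + (\<Phi> 0 - \<Phi>s) / \<rho>"]) auto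
  have E0: "E t \<ge> 0" if "t \<ge> 0" for t
    unfolding E_def using that \<rho> by (intro mult_nonneg_nonneg) (auto intro!: cSup_upper bdd)
  have E\<Phi>: "E t \<le> \<Phi> t - \<Phi>s" if "t \<ge> 0" for t
  proof -
    have "Sup (S ` {0..}) \<le> S t + (\<Phi> t - \<Phi>s) / \<rho>"
      using Sb[OF that] by (intro cSup_least) auto
    then show ?thesis using \<rho> by (simp add: E_def field_simps)
  qed
  have Ed: "\<rho> * integral {s..t} (\<lambda>\<tau>. (norm (D \<tau>))\<^sup>2) = E s - E t" if "0 \<le> s" "s \<le> t" for s t
    unfolding E_def Sdiff[OF that] by (simp add: algebra_simps)
  have Elim: "(E \<longlongrightarrow> 0) at_top"
  proof (rule tendsto_sandwich[of "\<lambda>_. 0" _ _ "\<lambda>t. \<Phi> t - \<Phi>s"])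
    show "\<forall>\<^sub>F t in at_top. 0 \<le> E t" "\<forall>\<^sub>F t in at_top. E t \<le> \<Phi> t - \<Phi>s"
      by (intro eventually_at_top_linorderI[of 0] E0 E\<Phi>; assumption)+
    show "((\<lambda>t. \<Phi> t - \<Phi>s) \<longlongrightarrow> 0) at_top" using lim by (rule LIM_zero)
  qed simp
  have \<Phi>anti: "\<Phi> t \<le> \<Phi> s" if "0 \<le> s" "s \<le> t" for s t
    using en[OF that] Henstock_Kurzweil_Integration.integral_nonneg[OF N2[OF that(1), of t]] \<rho>
    by (smt (verit) mult_nonneg_nonneg zero_le_power2)
  have len: "dist (x s) (x t) \<le> integral {s..t} (\<lambda>\<tau>. norm (D \<tau>))" if "0 \<le> s" "s \<le> t" for s t
    by (rule dist_le_integral_norm[OF ftc[OF that] Ni[OF that(1)]])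
  have xcont: "continuous_on {0..T} x" for T
  proof -
    have "continuous_on {0..T} (\<lambda>t. x 0 + integral {0..t} D)"
    proof (cases "0 \<le> T")
      case True
      show ?thesis
        by (intro continuous_intros indefinite_integral_continuous_1 has_integral_integrable[OF ftc[OF _ True]]) simp
    qed simp
    then show ?thesis
      by (rule continuous_on_eq) (use integral_unique[OF ftc[of 0]] in auto)
  qed
  fix \<epsilon> :: real assume \<epsilon>: "\<epsilon> > 0"
  show "\<exists>t0\<ge>0. \<forall>T\<ge>t0. integral {t0..T} (\<lambda>\<tau>. norm (D \<tau>)) \<le> \<epsilon>"
  \<comment> \<open>If no energy is left at \<open>t1\<close>, the quadratic integral vanishes
    afterwards and the trajectory stands still. This case is separate because \<open>\<psi>'\<close>
    is controlled only at positive arguments.\<close>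
  proof (cases "\<exists>t1\<ge>0. E t1 = 0")
    case True
    then obtain t1 where t1: "t1 \<ge> 0" "E t1 = 0" by blast
    have "integral {t1..T} (\<lambda>\<tau>. norm (D \<tau>)) \<le> \<epsilon>" if T: "T \<ge> t1" for T
    proof -
      have "\<rho> * integral {t1..T} (\<lambda>\<tau>. (norm (D \<tau>))\<^sup>2) \<le> 0"
        using Ed[OF t1(1) T] t1 E0[of T] T by simp
      then have I0: "integral {t1..T} (\<lambda>\<tau>. (norm (D \<tau>))\<^sup>2) \<le> 0" using \<rho> by (simp add: mult_le_0_iff)
      define d where "d = \<epsilon> / (T - t1 + 1)"
      have d: "d > 0" "d * (T - t1) \<le> \<epsilon>" using \<epsilon> T by (auto simp: d_def field_simps)
      have "integral {t1..T} (\<lambda>\<tau>. norm (D \<tau>)) \<le> d * (T - t1) + integral {t1..T} (\<lambda>\<tau>. (norm (D \<tau>))\<^sup>2) / d"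
        using t1 T d by (intro integral_norm_le_of_power2 Ni N2) auto
      also have "\<dots> \<le> \<epsilon> + 0" using d I0 by (intro add_mono) (auto simp: divide_le_0_iff)
      finally show ?thesis by simp
    qed
    then show ?thesis using t1(1) by blast
  next
    case False
    then have Epos: "E t > 0" if "t \<ge> 0" for t using E0[OF that] that by (metis less_eq_real_def)
    \<comment> \<open>The trajectory will start within \<open>r / 2\<close> of \<open>xs\<close> and
      travel at most \<open>b\<close>. The bound \<open>r / 4\<close> keeps it inside the ball, and
      the bound \<open>\<epsilon>\<close> gives the small tail.\<close>
    define b where "b = min \<epsilon> (r / 4)"
    have b: "b > 0" "b \<le> \<epsilon>" "b \<le> r / 4" using \<epsilon> r by (auto simp: b_def)
    have "((\<lambda>t. \<psi> (E t)) \<longlongrightarrow> \<psi> 0) at_top"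
    proof (rule continuous_on_tendsto_compose[OF contp Elim])
      have "\<forall>\<^sub>F t in at_top. E t < \<eta>" using order_tendstoD(2)[OF Elim \<eta>] .
      then show "\<forall>\<^sub>F t in at_top. E t \<in> {0..\<eta>}"
        using eventually_ge_at_top[of 0] by eventually_elim (auto intro: E0)
    qed (use \<eta> in simp)
    then have "((\<lambda>t. 2 * L / \<rho> * \<psi> (E t)) \<longlongrightarrow> 2 * L / \<rho> * \<psi> 0) at_top"
      by (intro tendsto_intros)
    then have "((\<lambda>t. 2 * L / \<rho> * \<psi> (E t)) \<longlongrightarrow> 0) at_top" using \<psi>0 by simp
    from order_tendstoD(2)[OF this b(1)] order_tendstoD(2)[OF lim, of "\<Phi>s + \<eta>"] \<eta> eventually_ge_at_top[of 0]
    have ev: "\<forall>\<^sub>F t in at_top. 2 * L / \<rho> * \<psi> (E t) < b \<and> \<Phi> t < \<Phi>s + \<eta> \<and> 0 \<le> t"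
      by (intro eventually_conj) auto
    obtain tn where tn: "filterlim tn at_top sequentially" "(\<lambda>n. x (tn n)) \<longlonglongrightarrow> xs"
      using om by (auto simp: omega_limit_def)
    have "\<forall>\<^sub>F n in sequentially. 2 * L / \<rho> * \<psi> (E (tn n)) < b \<and> \<Phi> (tn n) < \<Phi>s + \<eta> \<and> 0 \<le> tn n"
      using eventually_compose_filterlim[OF ev tn(1)] .
    moreover have "\<forall>\<^sub>F n in sequentially. dist (x (tn n)) xs < r / 2"
      using tendstoD[OF tn(2), of "r/2"] r by simp
    ultimately have "\<forall>\<^sub>F n in sequentially. (2 * L / \<rho> * \<psi> (E (tn n)) < b \<and> \<Phi> (tn n) < \<Phi>s + \<eta> \<and> 0 \<le> tn n)
        \<and> dist (x (tn n)) xs < r / 2"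
      by (rule eventually_conj)
    from eventually_happens[OF this] obtain t0
      where t0: "2 * L / \<rho> * \<psi> (E t0) < b" "\<Phi> t0 < \<Phi>s + \<eta>" "0 \<le> t0" "dist (x t0) xs < r / 2"
      by auto
    \<comment> \<open>Membership in the ball is assumed only before \<open>T\<close>, so that
      \<open>T\<close> may be a first exit time. The endpoint is accordingly added to the
      exceptional set.\<close>
    have est: "integral {t0..T} (\<lambda>\<tau>. norm (D \<tau>)) \<le> b"
      if T: "t0 \<le> T" and inb: "\<And>t. t \<in> {t0..<T} \<Longrightarrow> x t \<in> ball xs r" for T
    proof -
      have E\<eta>: "E t \<in> {0<..<\<eta>}" if "t \<in> {t0..T}" for t
        using that t0 Epos[of t] E\<Phi>[of t] \<Phi>anti[of t0 t] by auto
      have "integral {t0..T} (\<lambda>\<tau>. norm (D \<tau>)) \<le> 2 * L / \<rho> * (\<psi> (E t0) - \<psi> (E T))"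
      proof (rule KL_length_estimate[OF T L \<rho> Ni N2 norm_ge_zero _ E\<eta> conc der pos cont, where M = "insert T M"])
        show "\<rho> * integral {s..t} (\<lambda>\<tau>. (norm (D \<tau>))\<^sup>2) = E s - E t" if "t0 \<le> s" "s \<le> t" for s t
          using Ed[of s t] that t0 by simp
        fix t assume t: "t \<in> {t0..T} - insert T M"
        then have tt: "0 \<le> t" "t0 \<le> t" "t < T" "t \<notin> M" using t0 by auto
        have "0 < E t" "E t \<le> \<Phi> t - \<Phi>s" "\<Phi> t \<le> \<Phi> t0"
          using Epos tt E\<Phi> \<Phi>anti t0 by auto
        \<comment> \<open>Positivity of \<open>E t\<close> forces \<open>\<Phi>s < \<Phi> t\<close>,
          as \<open>KL\<close> requires. Antitonicity of \<open>\<psi>'\<close> then permits passing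
          from \<open>\<Phi> t - \<Phi>s\<close> down to \<open>E t\<close>.\<close>
        then have "1 \<le> \<psi>' (\<Phi> t - \<Phi>s) * (L * norm (D t))" "\<psi>' (\<Phi> t - \<Phi>s) \<le> \<psi>' (E t)"
          using tt t0 inb by (auto intro!: KL concave_on_deriv_antimono[OF conc der])
        moreover have "0 \<le> L * norm (D t)" using L by simp
        ultimately show "1 \<le> \<psi>' (E t) * (L * norm (D t))"
          by (meson mult_right_mono order_trans)
      qed (use t0 M in auto)
      also have "\<dots> \<le> 2 * L / \<rho> * \<psi> (E t0)"
        using E\<eta>[of T] T \<psi>nn[of "E T"] L \<rho> by (intro mult_left_mono) auto
      finally show ?thesis using t0(1) by simp
    qed
    have trap: "x T \<in> ball xs r" if T: "t0 \<le> T" for T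
    proof (rule ccontr)
      assume out: "x T \<notin> ball xs r"
      \<comment> \<open>At the first exit time \<open>T1\<close> the estimate \<open>est\<close>
        still applies, so \<open>x T1\<close> is less than \<open>r\<close> away from
        \<open>xs\<close>, contradicting the exit.\<close>
      define B where "B = {t \<in> {t0..T}. r \<le> dist xs (x t)}"
      have "continuous_on {t0..T} x"
        using t0 by (intro continuous_on_subset[OF xcont[of T]]) auto
      then have "closed B" unfolding B_def
        by (intro continuous_on_closed_Collect_le continuous_intros) auto
      moreover have "B \<subseteq> {t0..T}" by (auto simp: B_def)
      ultimately have "compact B" using compact_Int_closed[of "{t0..T}" B]
        by (simp add: Int_absorb1)
      moreover have "B \<noteq> {}" using out T by (auto simp: B_def)
      ultimately have "\<exists>T1\<in>B. \<forall>t\<in>B. T1 \<le> t" by (rule compact_attains_inf)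
      then obtain T1 where T1: "T1 \<in> B" "\<And>t. t \<in> B \<Longrightarrow> T1 \<le> t" by blast
      have "x t \<in> ball xs r" if "t \<in> {t0..<T1}" for t
        using T1 that by (force simp: B_def)
      then have "integral {t0..T1} (\<lambda>\<tau>. norm (D \<tau>)) \<le> b" using T1 by (intro est) (auto simp: B_def)
      moreover have "t0 \<le> T1" "r \<le> dist xs (x T1)" using T1 by (auto simp: B_def)
      ultimately show False
        using len[OF t0(3), of T1] t0(4) b(3) r dist_triangle[of xs "x T1" "x t0"]
        by (simp add: dist_commute)
    qed
    show ?thesis
      using est[OF _ trap] b(2) t0(3) by (intro exI[of _ t0]) (auto intro: order_trans)
  qed
qed

text \<open>If the speed exceeded \<open>\<epsilon>\<close> at every time of the unit interval
  outside \<open>M\<close>, its square would integrate to at least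
  \<open>\<epsilon>\<^sup>2\<close>. The displacement bound is
  \<open>integral_norm_le_of_power2\<close> with the same \<open>\<epsilon>\<close>, each summand
  contributing at most \<open>\<epsilon>\<close>.\<close>

lemma exists_slow_time:
  fixes x :: "real \<Rightarrow> 'a::euclidean_space"
  assumes ftc: "\<And>s t. 0 \<le> s \<Longrightarrow> s \<le> t \<Longrightarrow> (D has_integral (x t - x s)) {s..t}"
    and Ni: "\<And>s t. 0 \<le> s \<Longrightarrow> (\<lambda>\<tau>. norm (D \<tau>)) integrable_on {s..t}"
    and N2: "\<And>s t. 0 \<le> s \<Longrightarrow> (\<lambda>\<tau>. (norm (D \<tau>))\<^sup>2) integrable_on {s..t}"
    and M: "negligible M" and t: "t \<ge> 0" and \<epsilon>: "\<epsilon> > 0"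
    and small: "integral {t..t+1} (\<lambda>\<tau>. (norm (D \<tau>))\<^sup>2) < \<epsilon>\<^sup>2"
  obtains s where "t \<le> s" "s \<le> t + 1" "s \<notin> M" "norm (D s) \<le> \<epsilon>" "dist (x s) (x t) \<le> 2 * \<epsilon>"
proof -
  have "\<exists>s\<in>{t..t+1} - M. norm (D s) \<le> \<epsilon>"
  proof (rule ccontr)
    assume "\<not> ?thesis"
    then have *: "\<epsilon> < norm (D s)" if "s \<in> {t..t+1} - M" for s using that by force
    have "integral {t..t+1} (\<lambda>_. \<epsilon>\<^sup>2) \<le> integral {t..t+1} (\<lambda>\<tau>. (norm (D \<tau>))\<^sup>2)"
      using t \<epsilon> * by (intro integral_le_negligible[OF _ N2 M] power_mono) (auto intro: less_imp_le)
    then show False using small by simp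
  qed
  then obtain s where s: "t \<le> s" "s \<le> t + 1" "s \<notin> M" "norm (D s) \<le> \<epsilon>" by auto
  have "dist (x s) (x t) \<le> integral {t..s} (\<lambda>\<tau>. norm (D \<tau>))"
    using dist_le_integral_norm[OF ftc[OF t s(1)] Ni[OF t]] by (simp add: dist_commute)
  also have "\<dots> \<le> \<epsilon> * (s - t) + integral {t..s} (\<lambda>\<tau>. (norm (D \<tau>))\<^sup>2) / \<epsilon>"
    using t s \<epsilon> by (intro integral_norm_le_of_power2 Ni N2) auto
  also have "\<dots> \<le> \<epsilon> * 1 + \<epsilon>\<^sup>2 / \<epsilon>"
  proof (intro add_mono mult_left_mono divide_right_mono)
    have "integral {t..s} (\<lambda>\<tau>. (norm (D \<tau>))\<^sup>2) \<le> integral {t..t+1} (\<lambda>\<tau>. (norm (D \<tau>))\<^sup>2)"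
      using s t by (intro integral_subset_le N2) auto
    then show "integral {t..s} (\<lambda>\<tau>. (norm (D \<tau>))\<^sup>2) \<le> \<epsilon>\<^sup>2" using small by simp
  qed (use s \<epsilon> in auto)
  finally have "dist (x s) (x t) \<le> 2 * \<epsilon>" using \<epsilon> by (simp add: power2_eq_square)
  then show ?thesis using that s by blast
qed

section \<open>Energetic solutions\<close>

lemma has_integral_vector_derivative_abs_continuous:
  fixes x :: "real \<Rightarrow> 'a::euclidean_space"
  assumes AC: "\<And>c d. 0 \<le> c \<Longrightarrow> c \<le> d \<Longrightarrow> abs_continuous_on c d x"
    and N: "negligible N"
    and der: "\<And>t. 0 \<le> t \<Longrightarrow> t \<notin> N \<Longrightarrow> \<exists>x'. (x has_vector_derivative x') (at t)"
    and st: "0 \<le> s" "s \<le> t"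
  shows "((\<lambda>\<tau>. vector_derivative x (at \<tau>)) has_integral (x t - x s)) {s..t}"
proof (rule fundamental_theorem_of_calculus_abs_continuous[OF st(2) AC[OF st] N])
  fix \<tau> assume "\<tau> \<in> {s..t} - N"
  then have "\<exists>x'. (x has_vector_derivative x') (at \<tau>)" using der st by simp
  then have "(x has_vector_derivative vector_derivative x (at \<tau>)) (at \<tau>)"
    by (metis vector_derivative_at)
  then show "(x has_vector_derivative vector_derivative x (at \<tau>)) (at \<tau> within {s..t})"
    by (rule has_vector_derivative_at_within)
qed

text \<open>This passes from the nonnegative Lebesgue integral to the gauge integral. Gauge
  integrability of \<open>D\<close> supplies measurability; the norm is then integrable because it
  is dominated by \<open>1 + (norm (D \<tau>))\<^sup>2\<close>.\<close>

lemma integrable_on_power2_of_nn_integral: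
  fixes D :: "real \<Rightarrow> 'a::euclidean_space"
  assumes D: "(D has_integral I) {s..t}"
    and fin: "(\<integral>\<^sup>+\<tau>\<in>{s..t}. ennreal ((norm (D \<tau>))\<^sup>2) \<partial>lebesgue) < \<infinity>"
  shows "(\<lambda>\<tau>. (norm (D \<tau>))\<^sup>2) integrable_on {s..t}"
    and "ennreal (integral {s..t} (\<lambda>\<tau>. (norm (D \<tau>))\<^sup>2)) =
      (\<integral>\<^sup>+\<tau>\<in>{s..t}. ennreal ((norm (D \<tau>))\<^sup>2) \<partial>lebesgue)"
    and "(\<lambda>\<tau>. norm (D \<tau>)) integrable_on {s..t}"
proof -
  define f where "f \<tau> = (norm (indicator {s..t} \<tau> *\<^sub>R D \<tau>))\<^sup>2" for \<tau>
  have meas: "(\<lambda>\<tau>. indicator {s..t} \<tau> *\<^sub>R D \<tau>) \<in> borel_measurable lebesgue"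
    using has_integral_implies_lebesgue_measurable[OF D] .
  then have fm: "f \<in> borel_measurable lebesgue" unfolding f_def by measurable
  have f_eq: "f = (\<lambda>\<tau>. if \<tau> \<in> {s..t} then (norm (D \<tau>))\<^sup>2 else 0)"
    by (auto simp: f_def indicator_def)
  have int: "(\<integral>\<^sup>+\<tau>\<in>{s..t}. ennreal ((norm (D \<tau>))\<^sup>2) \<partial>lebesgue) = integral\<^sup>N lebesgue f"
    by (intro nn_integral_cong) (auto simp: f_eq indicator_def)
  obtain r where r: "integral\<^sup>N lebesgue f = ennreal r" "0 \<le> r"
    using fin unfolding int by (cases "integral\<^sup>N lebesgue f") auto
  then have "(f has_integral r) UNIV"
    using fm by (subst has_integral_iff_nn_integral_lebesgue) (auto simp: f_def)
  then have h: "((\<lambda>\<tau>. (norm (D \<tau>))\<^sup>2) has_integral r) {s..t}"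
    unfolding f_eq has_integral_restrict_UNIV .
  then show sq: "(\<lambda>\<tau>. (norm (D \<tau>))\<^sup>2) integrable_on {s..t}" by blast
  show "ennreal (integral {s..t} (\<lambda>\<tau>. (norm (D \<tau>))\<^sup>2)) =
      (\<integral>\<^sup>+\<tau>\<in>{s..t}. ennreal ((norm (D \<tau>))\<^sup>2) \<partial>lebesgue)"
    using r integral_unique[OF h] int by simp
  have "D absolutely_integrable_on {s..t}"
  proof (rule measurable_bounded_by_integrable_imp_absolutely_integrable)
    show "D \<in> borel_measurable (lebesgue_on {s..t})"
      using meas by (subst borel_measurable_restrict_space_iff) auto
    show "(\<lambda>\<tau>. 1 + (norm (D \<tau>))\<^sup>2) integrable_on {s..t}"
      using sq by (intro integrable_add) auto
    show "norm (D \<tau>) \<le> 1 + (norm (D \<tau>))\<^sup>2" for \<tau>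
      using sum_squares_bound[of 1 "norm (D \<tau>)"] norm_ge_zero[of "D \<tau>"] by (simp, linarith)
  qed simp
  then show "(\<lambda>\<tau>. norm (D \<tau>)) integrable_on {s..t}"
    by (rule absolutely_integrable_on_def[THEN iffD1, THEN conjunct2])
qed

text \<open>The gap below the sum is split: \<open>d\<close> lies below the first summand,
  \<open>e - d\<close> below the second, and their total \<open>e\<close> is still above
  \<open>c\<close>.\<close>

lemma lsc_at_add_real:
  fixes f :: "'a::topological_space \<Rightarrow> ereal" and g :: "'a \<Rightarrow> real"
  assumes f: "lsc_at f z" and g: "lsc_at (\<lambda>z. ereal (g z)) z" and fz: "f z \<noteq> -\<infinity>"
  shows "lsc_at (\<lambda>z. f z + ereal (g z)) z"
  unfolding lsc_at_def
proof (intro allI impI)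
  fix c assume c: "c < f z + ereal (g z)"
  then have "c - ereal (g z) < f z"
    by (cases c; cases "f z") auto
  then obtain d where d: "c - ereal (g z) < ereal d" "ereal d < f z"
    using ereal_dense2 by blast
  have cl: "c < ereal (d + g z)" using d(1) by (cases c) auto
  then obtain e where e: "c < ereal e" "e < d + g z"
    using ereal_dense2 by (metis ereal_less_eq(3) less_ereal.simps(1))
  have "\<forall>\<^sub>F y in nhds z. ereal d < f y" using f d(2) by (auto simp: lsc_at_def)
  moreover have "\<forall>\<^sub>F y in nhds z. ereal (e - d) < ereal (g y)"
    using g e(2) unfolding lsc_at_def by (metis less_diff_eq less_ereal.simps(1) diff_less_eq add.commute)
  ultimately show "\<forall>\<^sub>F y in nhds z. c < f y + ereal (g y)"
  proof eventually_elim
    case (elim y)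
    then show ?case using e(1) by (cases c; cases "f y") auto
  qed
qed

lemma lsc_at_le_of_tendsto:
  assumes f: "lsc_at f z" and lim: "y \<longlonglongrightarrow> z" and le: "\<forall>\<^sub>F n in sequentially. f (y n) \<le> B"
  shows "f z \<le> B"
proof (rule ccontr)
  assume "\<not> f z \<le> B"
  then have "\<forall>\<^sub>F w in nhds z. B < f w" using f by (simp add: lsc_at_def)
  then have "\<forall>\<^sub>F n in sequentially. B < f (y n)"
    using lim by (rule eventually_compose_filterlim)
  then have "\<forall>\<^sub>F n in sequentially. False" using le by eventually_elim auto
  then show False by simp
qed

text \<open>This turns the extended-real and almost-everywhere definition into real-valued data with
  gauge integrals and a single negligible set \<open>M\<close>, which is all that the convergence
  argument handles.\<close>

lemma energetic_solutionE:
  fixes \<phi>1 :: "'a::euclidean_space \<Rightarrow> ereal" and \<phi>2 :: "'a \<Rightarrow> real"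
  assumes nminf: "\<And>z. \<phi>1 z \<noteq> -\<infinity>" and x0: "\<phi>1 x0 \<noteq> \<infinity>"
    and sol: "is_energetic_solution \<phi>1 (\<lambda>z. ereal (\<phi>2 z)) F x0 x"
  obtains \<rho> M where "\<rho> > 0" "negligible M" "x 0 = x0"
    "\<And>t. t \<ge> 0 \<Longrightarrow> \<phi>1 (x t) \<noteq> \<infinity>"
    "\<And>s t. 0 \<le> s \<Longrightarrow> s \<le> t \<Longrightarrow> ((\<lambda>\<tau>. vector_derivative x (at \<tau>)) has_integral (x t - x s)) {s..t}"
    "\<And>s t. 0 \<le> s \<Longrightarrow> (\<lambda>\<tau>. norm (vector_derivative x (at \<tau>))) integrable_on {s..t}"
    "\<And>s t. 0 \<le> s \<Longrightarrow> (\<lambda>\<tau>. (norm (vector_derivative x (at \<tau>)))\<^sup>2) integrable_on {s..t}"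
    "\<And>s t. 0 \<le> s \<Longrightarrow> s \<le> t \<Longrightarrow> \<rho> * integral {s..t} (\<lambda>\<tau>. (norm (vector_derivative x (at \<tau>)))\<^sup>2)
        \<le> (real_of_ereal (\<phi>1 (x s)) + \<phi>2 (x s)) - (real_of_ereal (\<phi>1 (x t)) + \<phi>2 (x t))"
    "\<And>t. t \<ge> 0 \<Longrightarrow> t \<notin> M \<Longrightarrow> \<exists>v w. v \<in> clarke_subdiff \<phi>1 (x t) \<and>
        w \<in> clarke_subdiff (\<lambda>z. ereal (\<phi>2 z)) (x t) \<and>
        - (v + w) \<in> graphical_deriv F (x t) (vector_derivative x (at t))"
proof -
  let ?D = "\<lambda>\<tau>. vector_derivative x (at \<tau>)"
  let ?J = "\<lambda>s t. \<integral>\<^sup>+\<tau>\<in>{s..t}. ennreal ((norm (?D \<tau>))\<^sup>2) \<partial>lebesgue"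
  obtain \<rho> where \<rho>: "\<rho> > 0" and en: "\<And>s t. 0 \<le> s \<Longrightarrow> s < t \<Longrightarrow>
      ereal \<rho> * enn2ereal (?J s t) \<le> (\<phi>1 (x s) + ereal (\<phi>2 (x s))) - (\<phi>1 (x t) + ereal (\<phi>2 (x t)))"
    using sol unfolding is_energetic_solution_def by blast
  have s: "is_solution \<phi>1 (\<lambda>z. ereal (\<phi>2 z)) F x0 x" using sol by (simp add: is_energetic_solution_def)
  have x00: "x 0 = x0" and AC: "\<And>c d. 0 \<le> c \<Longrightarrow> c \<le> d \<Longrightarrow> abs_continuous_on c d x"
    using s by (auto simp: is_solution_def)
  obtain v w where "AE t in lebesgue. t \<ge> 0 \<longrightarrow>
           v t \<in> clarke_subdiff \<phi>1 (x t) \<and> w t \<in> clarke_subdiff (\<lambda>z. ereal (\<phi>2 z)) (x t) \<and>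
           (\<exists>x'. (x has_vector_derivative x') (at t) \<and>
                 v t + w t \<in> uminus ` graphical_deriv F (x t) x')" (is "AE t in lebesgue. t \<ge> 0 \<longrightarrow> ?P t")
    using s unfolding is_solution_def by blast
  then obtain M where M: "M \<in> null_sets lebesgue" "{t \<in> space lebesgue. \<not> (t \<ge> 0 \<longrightarrow> ?P t)} \<subseteq> M"
    unfolding eventually_ae_filter by blast
  have inc: "?P t" if "t \<ge> 0" "t \<notin> M" for t
  proof (rule ccontr)
    assume "\<not> ?P t"
    with that(1) have "t \<in> {t \<in> space lebesgue. \<not> (t \<ge> 0 \<longrightarrow> ?P t)}" by simp
    with M(2) that(2) show False by blast
  qed
  have negM: "negligible M" using M(1) by (simp add: negligible_iff_null_sets)
  have ftc: "(?D has_integral (x t - x s)) {s..t}" if "0 \<le> s" "s \<le> t" for s t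
    by (rule has_integral_vector_derivative_abs_continuous[OF AC negM _ that]) (use inc in blast)+
  have J0: "0 \<le> ereal \<rho> * enn2ereal (?J s t)" for s t using \<rho> by simp
  have fin: "\<phi>1 (x t) \<noteq> \<infinity>" if "t \<ge> 0" for t
  proof (cases "t = 0")
    case False
    then have "0 < t" using that by simp
    \<comment> \<open>The initial energy is real, so an infinite energy at \<open>t\<close> would
      make the right-hand side minus infinity.\<close>
    have "0 \<le> (\<phi>1 x0 + ereal (\<phi>2 x0)) - (\<phi>1 (x t) + ereal (\<phi>2 (x t)))"
      using order_trans[OF J0 en[OF order_refl \<open>0 < t\<close>]] unfolding x00 .
    then show ?thesis using x0 nminf[of x0] by (cases "\<phi>1 x0") auto
  qed (use x0 x00 in simp)
  define \<Phi> where "\<Phi> t = real_of_ereal (\<phi>1 (x t)) + \<phi>2 (x t)" for t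
  have \<phi>\<Phi>: "\<phi>1 (x t) + ereal (\<phi>2 (x t)) = ereal (\<Phi> t)" if "t \<ge> 0" for t
    using fin[OF that] nminf[of "x t"] by (cases "\<phi>1 (x t)") (auto simp: \<Phi>_def)
  have en': "ereal \<rho> * enn2ereal (?J s t) \<le> ereal (\<Phi> s - \<Phi> t)" if "0 \<le> s" "s < t" for s t
    using en[OF that] \<phi>\<Phi> that by simp
  have Jfin: "?J s t < \<infinity>" if "0 \<le> s" "s < t" for s t
    using en'[OF that] \<rho> by (cases "?J s t") (auto simp: top_unique)
  have Ni: "(\<lambda>\<tau>. norm (?D \<tau>)) integrable_on {s..t}" and N2: "(\<lambda>\<tau>. (norm (?D \<tau>))\<^sup>2) integrable_on {s..t}"
    if "0 \<le> s" for s t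
  proof -
    have "(\<lambda>\<tau>. norm (?D \<tau>)) integrable_on {s..t} \<and> (\<lambda>\<tau>. (norm (?D \<tau>))\<^sup>2) integrable_on {s..t}"
    proof (cases "s < t")
      case True
      then show ?thesis
        using integrable_on_power2_of_nn_integral(1,3)[OF ftc Jfin] that by simp
    next
      case False
      then have "measure lborel (cbox s t) = 0" by simp
      then show ?thesis unfolding box_real(2)[symmetric] by (intro conjI integrable_on_null)
    qed
    then show "(\<lambda>\<tau>. norm (?D \<tau>)) integrable_on {s..t}" "(\<lambda>\<tau>. (norm (?D \<tau>))\<^sup>2) integrable_on {s..t}"
      by auto
  qed
  have "\<rho> * integral {s..t} (\<lambda>\<tau>. (norm (?D \<tau>))\<^sup>2) \<le> \<Phi> s - \<Phi> t" if "0 \<le> s" "s \<le> t" for s t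
  proof (cases "s < t")
    case True
    let ?I = "integral {s..t} (\<lambda>\<tau>. (norm (?D \<tau>))\<^sup>2)"
    have "0 \<le> ?I" by (intro Henstock_Kurzweil_Integration.integral_nonneg N2 that) auto
    moreover have "ennreal ?I = ?J s t"
      by (rule integrable_on_power2_of_nn_integral(2)[OF ftc[OF that] Jfin[OF that(1) True]])
    ultimately have "enn2ereal (?J s t) = ereal ?I" by (metis enn2ereal_ennreal)
    then show ?thesis using en'[OF that(1) True] by simp
  qed (use that in simp)
  moreover have "\<exists>v w. v \<in> clarke_subdiff \<phi>1 (x t) \<and>
        w \<in> clarke_subdiff (\<lambda>z. ereal (\<phi>2 z)) (x t) \<and> - (v + w) \<in> graphical_deriv F (x t) (?D t)"
    if t: "t \<ge> 0" "t \<notin> M" for t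
  proof -
    obtain x' where x': "(x has_vector_derivative x') (at t)" "v t + w t \<in> uminus ` graphical_deriv F (x t) x'"
      using inc[OF t] by blast
    then obtain u where "v t + w t = - u" "u \<in> graphical_deriv F (x t) x'" by blast
    then have "- (v t + w t) \<in> graphical_deriv F (x t) (?D t)"
      by (simp only: minus_minus vector_derivative_at[OF x'(1)])
    then show ?thesis using inc[OF t] by blast
  qed
  ultimately show ?thesis
    using that[OF \<rho> negM x00 fin ftc Ni N2] unfolding \<Phi>_def by blast
qed

theorem theorem4p5:
  fixes \<phi>1 :: "'a::euclidean_space \<Rightarrow> ereal"
    and \<phi>2 :: "'a \<Rightarrow> real"
    and \<phi> :: "'a \<Rightarrow> ereal"
    and F :: "'a \<Rightarrow> 'a"
    and x0 xstar :: 'a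
    and \<Omega> :: "'a set"
    and x :: "real \<Rightarrow> 'a"
  assumes "\<And>z. \<phi>1 z \<noteq> -\<infinity>"
    and "lsc_on UNIV \<phi>1"
    and "lsc_on UNIV (\<lambda>z. ereal (\<phi>2 z))"
    and "\<phi> = (\<lambda>z. \<phi>1 z + ereal (\<phi>2 z))"
    and "x0 \<in> edom \<phi>"
    and "open \<Omega>"
    and "{z. \<phi> z \<le> \<phi> x0} \<subseteq> \<Omega>"
    and "plr_on \<Omega> \<phi>1"
    and "locally_lipschitz_on \<Omega> \<phi>2"
    and "locally_lipschitz_on \<Omega> F"
    and "is_energetic_solution \<phi>1 (\<lambda>z. ereal (\<phi>2 z)) F x0 x"
    and "xstar \<in> omega_limit x"
    and "structured_KL \<phi>1 (\<lambda>z. ereal (\<phi>2 z)) xstar"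
  shows "(\<lambda>t. vector_derivative x (at t)) absolutely_integrable_on {0..}
    \<and> (x \<longlongrightarrow> xstar) at_top
    \<and> ((\<lambda>t. \<phi> (x t)) \<longlongrightarrow> \<phi> xstar) at_top"
proof -
  define D where "D t = vector_derivative x (at t)" for t
  define \<Phi> where "\<Phi> t = real_of_ereal (\<phi>1 (x t)) + \<phi>2 (x t)" for t
  define \<Phi>s where "\<Phi>s = real_of_ereal (\<phi>1 xstar) + \<phi>2 xstar"
  have x0: "\<phi>1 x0 \<noteq> \<infinity>" using assms(4,5) by (auto simp: edom_def)
  obtain \<rho> M where \<rho>: "\<rho> > 0" and M: "negligible M" and x00: "x 0 = x0"
    and fin: "\<And>t. t \<ge> 0 \<Longrightarrow> \<phi>1 (x t) \<noteq> \<infinity>"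
    and ftc: "\<And>s t. 0 \<le> s \<Longrightarrow> s \<le> t \<Longrightarrow> (D has_integral (x t - x s)) {s..t}"
    and Ni: "\<And>s t. 0 \<le> s \<Longrightarrow> (\<lambda>\<tau>. norm (D \<tau>)) integrable_on {s..t}"
    and N2: "\<And>s t. 0 \<le> s \<Longrightarrow> (\<lambda>\<tau>. (norm (D \<tau>))\<^sup>2) integrable_on {s..t}"
    and en: "\<And>s t. 0 \<le> s \<Longrightarrow> s \<le> t \<Longrightarrow> \<rho> * integral {s..t} (\<lambda>\<tau>. (norm (D \<tau>))\<^sup>2) \<le> \<Phi> s - \<Phi> t"
    and inc: "\<And>t. t \<ge> 0 \<Longrightarrow> t \<notin> M \<Longrightarrow> \<exists>v w. v \<in> clarke_subdiff \<phi>1 (x t) \<and>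
        w \<in> clarke_subdiff (\<lambda>z. ereal (\<phi>2 z)) (x t) \<and> - (v + w) \<in> graphical_deriv F (x t) (D t)"
    using energetic_solutionE[OF assms(1) x0 assms(11)] unfolding D_def \<Phi>_def by blast
  have \<phi>\<Phi>: "\<phi> (x t) = ereal (\<Phi> t)" if "t \<ge> 0" for t
    using fin[OF that] assms(1)[of "x t"] by (cases "\<phi>1 (x t)") (auto simp: \<Phi>_def assms(4))
  have \<Phi>anti: "\<Phi> t \<le> \<Phi> s" if "0 \<le> s" "s \<le> t" for s t
    using en[OF that] Henstock_Kurzweil_Integration.integral_nonneg[OF N2[OF that(1), of t]] \<rho>
    by (smt (verit) mult_nonneg_nonneg zero_le_power2)
  obtain tn where tn: "\<And>n. tn n \<ge> 0" "filterlim tn at_top sequentially" "(\<lambda>n. x (tn n)) \<longlonglongrightarrow> xstar"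
    using assms(12) by (auto simp: omega_limit_def)

  \<comment> \<open>Location of the limit point and the lower bound for the energy\<close>
  have "lsc_at \<phi> xstar"
    unfolding assms(4) using assms(1-3) by (intro lsc_at_add_real) (auto simp: lsc_on_def)
  then have star_le: "\<phi> xstar \<le> ereal (\<Phi> t)" if "t \<ge> 0" for t
  proof (rule lsc_at_le_of_tendsto[OF _ tn(3)])
    \<comment> \<open>Monotonicity bounds the energy at all late \<open>tn n\<close> by
      \<open>\<Phi> t\<close>, and lower semicontinuity carries the bound to
      \<open>xstar\<close>.\<close>
    have "\<forall>\<^sub>F n in sequentially. t \<le> tn n" using tn(2) by (simp add: filterlim_at_top)
    then show "\<forall>\<^sub>F n in sequentially. \<phi> (x (tn n)) \<le> ereal (\<Phi> t)"
      by eventually_elim (use \<phi>\<Phi> \<Phi>anti that tn(1) in auto)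
  qed
  then have "\<phi> xstar \<le> \<phi> x0" using \<phi>\<Phi>[of 0] x00 by (metis order_refl)
  then have x\<Omega>: "xstar \<in> \<Omega>" using assms(7) by blast
  have fins: "\<phi>1 xstar \<noteq> \<infinity>" using star_le[of 0] by (auto simp: assms(4))
  then have \<phi>s: "\<phi> xstar = ereal \<Phi>s"
    using assms(1)[of xstar] by (cases "\<phi>1 xstar") (auto simp: \<Phi>s_def assms(4))
  have \<Phi>s: "\<Phi>s \<le> \<Phi> t" if "t \<ge> 0" for t using star_le[OF that] \<phi>s by simp

  \<comment> \<open>Lipschitz bounds near the limit point\<close>
  obtain r1 K where r1: "r1 > 0" "K-lipschitz_on (ball xstar r1) \<phi>2"
    using locally_lipschitz_on_ball[OF assms(9,6) x\<Omega>] by metis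
  obtain r2 L where r2: "r2 > 0" "L-lipschitz_on (ball xstar r2) F"
    using locally_lipschitz_on_ball[OF assms(10,6) x\<Omega>] by metis
  have K0: "K \<ge> 0" and L0: "L \<ge> 0" using r1 r2 lipschitz_on_nonneg by blast+
  have normF: "norm (v + w) \<le> L * norm (D t)"
    if inb: "x t \<in> ball xstar r2" and gd: "- (v + w) \<in> graphical_deriv F (x t) (D t)" for t v w
  proof -
    obtain d where d: "d > 0" "ball (x t) d \<subseteq> ball xstar r2"
      by (rule openE[OF open_ball inb])
    show ?thesis
      using norm_graphical_deriv_le_lipschitz[OF lipschitz_on_subset[OF r2(2) d(2)] d(1) gd]
      unfolding norm_minus_cancel .
  qed
  have normw: "norm w \<le> K"
    if inb: "x t \<in> ball xstar r1" and sd: "w \<in> clarke_subdiff (\<lambda>z. ereal (\<phi>2 z)) (x t)" for t w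
  proof -
    obtain d where d: "d > 0" "ball (x t) d \<subseteq> ball xstar r1"
      by (rule openE[OF open_ball inb])
    show ?thesis
      using norm_clarke_subdiff_le_lipschitz[OF lipschitz_on_subset[OF r1(2) d(2)] d(1) sd] .
  qed

  \<comment> \<open>Convergence of the energy to its value at the limit point\<close>
  have "\<exists>s\<ge>0. \<Phi> s \<le> \<Phi>s + e" if e: "e > 0" for e
  proof -
    obtain r3 c where r3: "r3 > 0" "c \<ge> 0" and plr: "\<And>z \<zeta> y. z \<in> ball xstar r3 \<Longrightarrow>
        \<zeta> \<in> clarke_subdiff \<phi>1 z \<Longrightarrow> y \<in> ball xstar r3 \<Longrightarrow>
        \<phi>1 y \<ge> \<phi>1 z + ereal (\<zeta> \<bullet> (y - z) - c * (1 + norm \<zeta>) * (norm (y - z))\<^sup>2)"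
      using assms(8) x\<Omega> unfolding plr_on_def plr_at_def dom_subdiff_def by blast
    \<comment> \<open>With \<open>x s\<close> within \<open>3 * \<epsilon>\<close> of
      \<open>xstar\<close> and \<open>norm v \<le> L + K\<close>, the three summands come from the
      inner product, the quadratic term of primal lower regularity, and the variation of
      \<open>\<phi>2\<close>.\<close>
    define C where "C = 3 * (L + K) + 9 * c * (1 + (L + K)) + 3 * K"
    have C: "C \<ge> 0" using K0 L0 r3 by (simp add: C_def)
    \<comment> \<open>The quarters put \<open>3 * \<epsilon>\<close> below every radius, the last
      entry gives \<open>\<epsilon> * C \<le> e\<close>, and \<open>\<epsilon> \<le> 1\<close>
      bounds the speed at \<open>s\<close> by 1 and \<open>\<epsilon>\<^sup>2\<close> by
      \<open>\<epsilon>\<close>.\<close>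
    define \<epsilon> where "\<epsilon> = Min {1, r1 / 4, r2 / 4, r3 / 4, e / (C + 1)}"
    have \<epsilon>0: "\<epsilon> > 0" using r1(1) r2(1) r3(1) e C by (simp add: \<epsilon>_def)
    have \<epsilon>_le: "\<epsilon> \<le> 1" "\<epsilon> \<le> r1 / 4" "\<epsilon> \<le> r2 / 4" "\<epsilon> \<le> r3 / 4" "\<epsilon> \<le> e / (C + 1)"
      unfolding \<epsilon>_def by (intro Min_le; simp)+
    then have \<epsilon>: "\<epsilon> > 0" "\<epsilon> \<le> 1" "3 * \<epsilon> < r1" "3 * \<epsilon> < r2" "3 * \<epsilon> < r3"
      using \<epsilon>0 by auto
    from \<epsilon>_le(5) have \<epsilon>C: "\<epsilon> * C \<le> e" using C \<epsilon>(1) by (simp add: field_simps)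
    have bdd: "bdd_below (\<Phi> ` {0..})" using \<Phi>s by (intro bdd_belowI[of _ \<Phi>s]) auto
    \<comment> \<open>The infimum serves as the limit of \<open>\<Phi>\<close>, not yet known to be
      \<open>\<Phi>s\<close>. Once \<open>\<Phi>\<close> is within
      \<open>\<rho> * \<epsilon>\<^sup>2\<close> of it, the dissipation still to come is small
      enough for \<open>exists_slow_time\<close>.\<close>
    have "Inf (\<Phi> ` {0..}) < Inf (\<Phi> ` {0..}) + \<rho> * \<epsilon>\<^sup>2" using \<rho> \<epsilon>(1) by simp
    then have "\<exists>y\<in>\<Phi> ` {0..}. y < Inf (\<Phi> ` {0..}) + \<rho> * \<epsilon>\<^sup>2" by (rule cInf_lessD[rotated]) auto
    then obtain t1 where t1: "t1 \<ge> 0" "\<Phi> t1 < Inf (\<Phi> ` {0..}) + \<rho> * \<epsilon>\<^sup>2" by auto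
    have "\<forall>\<^sub>F n in sequentially. t1 \<le> tn n" using tn(2) by (simp add: filterlim_at_top)
    moreover have "\<forall>\<^sub>F n in sequentially. dist (x (tn n)) xstar < \<epsilon>" using tendstoD[OF tn(3) \<epsilon>(1)] .
    ultimately have "\<forall>\<^sub>F n in sequentially. t1 \<le> tn n \<and> dist (x (tn n)) xstar < \<epsilon>"
      by (rule eventually_conj)
    from eventually_happens[OF this] obtain t where t: "t1 \<le> t" "dist (x t) xstar < \<epsilon>" by auto
    have t0: "t \<ge> 0" using t t1 by simp
    have "\<rho> * integral {t..t+1} (\<lambda>\<tau>. (norm (D \<tau>))\<^sup>2) \<le> \<Phi> t - \<Phi> (t + 1)" using t0 by (intro en) auto
    also have "\<dots> < \<rho> * \<epsilon>\<^sup>2"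
    proof -
      have "Inf (\<Phi> ` {0..}) \<le> \<Phi> (t + 1)" using t0 by (intro cInf_lower bdd) auto
      then show ?thesis using t1 \<Phi>anti[OF t1(1) t(1)] by simp
    qed
    finally have small: "integral {t..t+1} (\<lambda>\<tau>. (norm (D \<tau>))\<^sup>2) < \<epsilon>\<^sup>2" using \<rho> by simp
    obtain s where s: "t \<le> s" "s \<notin> M" "norm (D s) \<le> \<epsilon>" "dist (x s) (x t) \<le> 2 * \<epsilon>"
      using exists_slow_time[OF ftc Ni N2 M t0 \<epsilon>(1) small] by metis
    have s0: "s \<ge> 0" using s t0 by simp
    define d where "d = norm (xstar - x s)"
    have d: "0 \<le> d" "d \<le> 3 * \<epsilon>"
      using dist_triangle[of "x s" xstar "x t"] s(4) t(2) by (auto simp: d_def dist_norm norm_minus_commute)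
    have inb: "x s \<in> ball xstar r1" "x s \<in> ball xstar r2" "x s \<in> ball xstar r3"
      using d \<epsilon> by (auto simp: d_def dist_norm)
    obtain v w where vw: "v \<in> clarke_subdiff \<phi>1 (x s)" "w \<in> clarke_subdiff (\<lambda>z. ereal (\<phi>2 z)) (x s)"
        "- (v + w) \<in> graphical_deriv F (x s) (D s)"
      using inc[OF s0 s(2)] by blast
    have "norm (v + w) \<le> L * 1"
      using normF[OF inb(2) vw(3)] s(3) \<epsilon>(2) L0 by (meson mult_left_mono order_trans)
    then have v: "norm v \<le> L + K"
      using normw[OF inb(1) vw(2)] norm_triangle_ineq4[of "v + w" w] by simp
    obtain a b where ab: "\<phi>1 (x s) = ereal a" "\<phi>1 xstar = ereal b"
      using fin[OF s0] fins assms(1) by (metis ereal_cases)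
    \<comment> \<open>Primal lower regularity at \<open>x s\<close>, tested at \<open>xstar\<close>,
      bounds \<open>\<phi>1 (x s)\<close> from above by \<open>\<phi>1 xstar\<close>, the direction
      that lower semicontinuity does not give.\<close>
    have "a + (v \<bullet> (xstar - x s) - c * (1 + norm v) * d\<^sup>2) \<le> b"
      using plr[OF inb(3) vw(1), of xstar] r3(1) ab by (simp add: d_def)
    moreover have "- (v \<bullet> (xstar - x s)) \<le> (L + K) * (3 * \<epsilon>)"
    proof -
      have "- (v \<bullet> (xstar - x s)) \<le> norm v * d"
        using Cauchy_Schwarz_ineq2[of v "xstar - x s"] by (simp add: d_def)
      also have "\<dots> \<le> (L + K) * (3 * \<epsilon>)" using v d K0 L0 by (intro mult_mono) auto
      finally show ?thesis .
    qed
    moreover have "c * (1 + norm v) * d\<^sup>2 \<le> c * (1 + (L + K)) * (9 * \<epsilon>)"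
    proof (intro mult_mono)
      have "d\<^sup>2 \<le> (3 * \<epsilon>)\<^sup>2" using d by (intro power_mono)
      also have "\<dots> = 9 * (\<epsilon> * \<epsilon>)" by (simp add: power2_eq_square)
      also have "\<dots> \<le> 9 * \<epsilon>" using \<epsilon> by (simp add: mult_left_le)
      finally show "d\<^sup>2 \<le> 9 * \<epsilon>" .
    qed (use v r3 K0 L0 in auto)
    moreover have "\<phi>2 (x s) - \<phi>2 xstar \<le> K * (3 * \<epsilon>)"
    proof -
      have "\<phi>2 (x s) - \<phi>2 xstar \<le> K * d"
        using lipschitz_onD[OF r1(2) inb(1), of xstar] r1(1)
        by (simp add: d_def dist_norm norm_minus_commute)
      also have "\<dots> \<le> K * (3 * \<epsilon>)" using d K0 by (intro mult_left_mono)
      finally show ?thesis .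
    qed
    ultimately have "\<Phi> s \<le> \<Phi>s + \<epsilon> * C"
      using ab by (simp add: \<Phi>_def \<Phi>s_def C_def algebra_simps)
    then show ?thesis using s0 \<epsilon>C by (intro exI[of _ s]) simp
  qed
  \<comment> \<open>As \<open>\<Phi>\<close> is nonincreasing and bounded below by
    \<open>\<Phi>s\<close>, a single time with a value near \<open>\<Phi>s\<close> settles all later
    ones.\<close>
  then have lim: "(\<Phi> \<longlongrightarrow> \<Phi>s) at_top"
  proof (intro tendstoI)
    fix e :: real assume "e > 0"
    then obtain s where s: "s \<ge> 0" "\<Phi> s \<le> \<Phi>s + e / 2"
      using \<open>\<And>e. e > 0 \<Longrightarrow> \<exists>s\<ge>0. \<Phi> s \<le> \<Phi>s + e\<close>[of "e / 2"] by auto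
    show "\<forall>\<^sub>F t in at_top. dist (\<Phi> t) \<Phi>s < e"
    proof (rule eventually_at_top_linorderI[of s])
      fix t assume "s \<le> t"
      then show "dist (\<Phi> t) \<Phi>s < e"
        using \<Phi>anti[of s t] \<Phi>s[of t] s \<open>e > 0\<close> by (simp add: dist_real_def)
    qed
  qed

  \<comment> \<open>The Kurdyka--Lojasiewicz inequality along the trajectory\<close>
  obtain \<eta> \<psi> \<psi>' where \<eta>: "\<eta> > 0" and contp: "continuous_on {0..\<eta>} \<psi>" and conc: "concave_on {0..\<eta>} \<psi>"
    and \<psi>nn: "\<And>s. s \<in> {0..\<eta>} \<Longrightarrow> \<psi> s \<ge> 0" and \<psi>0: "\<psi> 0 = 0"
    and der: "\<And>s. s \<in> {0<..<\<eta>} \<Longrightarrow> (\<psi> has_real_derivative \<psi>' s) (at s)"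
    and pos: "\<And>s. s \<in> {0<..<\<eta>} \<Longrightarrow> \<psi>' s > 0"
    and cont: "continuous_on {0<..<\<eta>} \<psi>'"
    and KL: "\<And>z. z \<in> ball xstar \<eta> \<Longrightarrow> \<phi> xstar < \<phi> z \<Longrightarrow> \<phi> z < \<phi> xstar + ereal \<eta> \<Longrightarrow>
         1 \<le> ereal (\<psi>' (real_of_ereal (\<phi> z - \<phi> xstar))) *
             ext_dist 0 (clarke_subdiff \<phi>1 z + clarke_subdiff (\<lambda>z. ereal (\<phi>2 z)) z)"
    using assms(13) unfolding structured_KL_def Let_def assms(4) by blast
  have "D absolutely_integrable_on {0..} \<and> (x \<longlongrightarrow> xstar) at_top"
  proof (rule KL_convergence[OF ftc Ni N2 \<rho> en \<Phi>s lim assms(12) \<eta> contp conc \<psi>0 \<psi>nn der pos cont M])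
    \<comment> \<open>The constant has to be positive while \<open>L\<close> may be 0. In the
      smaller of the two balls both the Lipschitz bound on \<open>F\<close> and the
      Kurdyka--Lojasiewicz inequality are available.\<close>
    show "L + 1 > 0" "min r2 \<eta> > 0" using L0 r2 \<eta> by auto
    fix t assume t: "t \<ge> 0" "t \<notin> M" "x t \<in> ball xstar (min r2 \<eta>)" "\<Phi>s < \<Phi> t" "\<Phi> t < \<Phi>s + \<eta>"
    obtain v w where vw: "v \<in> clarke_subdiff \<phi>1 (x t)" "w \<in> clarke_subdiff (\<lambda>z. ereal (\<phi>2 z)) (x t)"
        "- (v + w) \<in> graphical_deriv F (x t) (D t)"
      using inc[OF t(1,2)] by blast
    let ?S = "clarke_subdiff \<phi>1 (x t) + clarke_subdiff (\<lambda>z. ereal (\<phi>2 z)) (x t)"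
    \<comment> \<open>The sum \<open>v + w\<close> belongs to the Minkowski sum, so its norm bounds
      the distance; the inclusion and \<open>normF\<close> bound that norm by the speed.\<close>
    have "ext_dist 0 ?S \<le> ereal (dist 0 (v + w))"
      unfolding ext_dist_def using vw by (intro INF_lower set_plus_intro)
    also have "\<dots> \<le> ereal ((L + 1) * norm (D t))"
      using normF[of t v w] t(3) vw(3) by (simp add: algebra_simps add_increasing)
    finally have le: "ext_dist 0 ?S \<le> ereal ((L + 1) * norm (D t))" .
    have p: "\<psi>' (\<Phi> t - \<Phi>s) > 0" using t by (intro pos) auto
    have "1 \<le> ereal (\<psi>' (\<Phi> t - \<Phi>s)) * ext_dist 0 ?S"
      using KL[of "x t"] t \<phi>\<Phi>[OF t(1)] \<phi>s by simp
    also have "\<dots> \<le> ereal (\<psi>' (\<Phi> t - \<Phi>s)) * ereal ((L + 1) * norm (D t))"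
      using le p by (intro ereal_mult_left_mono) auto
    finally show "1 \<le> \<psi>' (\<Phi> t - \<Phi>s) * ((L + 1) * norm (D t))"
      by (simp add: one_ereal_def)
  qed
  moreover have "((\<lambda>t. \<phi> (x t)) \<longlongrightarrow> \<phi> xstar) at_top"
  proof (rule Lim_transform_eventually)
    show "((\<lambda>t. ereal (\<Phi> t)) \<longlongrightarrow> \<phi> xstar) at_top" unfolding \<phi>s using lim by (intro tendsto_intros)
    show "\<forall>\<^sub>F t in at_top. ereal (\<Phi> t) = \<phi> (x t)"
      using \<phi>\<Phi> by (intro eventually_at_top_linorderI[of 0]) simp
  qed
  ultimately show ?thesis unfolding D_def by blast
qed

end
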